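(* Let $\mathcal K$ be a class of finite relational structures such that $\mathcal K_\omega$ has the $n$-ary Borel amalgamation property $\mathrm{BAP}_n$ for some $n\ge 2$, and let $M$ be the Fraïssé limit of $\mathcal K$. Then the isomorphism relation on $\mathcal K_\omega$ is Borel reducible to the conjugacy relation on $\mathrm{Aut}(M)$.
   Context: $\mathcal K_\omega$ is the class of countable structures all of whose finite substructures lie in $\mathcal K$ (coded as structures on subsets of $\mathbb N$). $\mathcal K$ has the amalgamation property (AP) if for $A,B_1,B_2\in\mathcal K$ and embeddings $g_i\colon A\to B_i$ there are $C\in\mathcal K$ and embeddings $f_i\colon B_i\to C$ with $f_1g_1=f_2g_2$; it has the strong amalgamation property (SAP) if moreover one can take $f_1(B_1)\cap f_2(B_2)=f_1g_1(A)$ (the same definitions apply to a class of countable structures). If $\mathcal K$ has AP, its Fraïssé limit $M$ is the unique countable homogeneous structure in $\mathcal K_\omega$ whose finite substructures are exactly $\mathcal K$. For a class $\mathcal C$ of countable structures and $A\in\mathcal C$, a quantifier-free type $\tau(x,\bar a)$ over a finite subset $A_0\subseteq A$ is an admissible finitary type over $A$ if some $B\in\mathcal C$ has $A$ as a substructure and contains a witness for $\tau$. A class $\mathcal C$ of countable structures with SAP has $\mathrm{BAP}_n$ if there is a Borel assignment $E\colon\mathcal C\to\mathcal C$ such that: (1) for all $A\in\mathcal C$, $E(A)$ consists of $A$ together with $n$ witnesses $x^\tau_1,\ldots,x^\tau_n$ for each admissible finitary type $\tau$ over $A$; (2) $E(A)$ has an automorphism fixing $A$ pointwise and cycling $x^\tau_1\mapsto\cdots\mapsto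 x^\tau_n\mapsto x^\tau_1$ for each $\tau$; (3) for admissible finitary types $\tau,\tau'$, the map $x^\tau_i\mapsto x^{\tau'}_i$ ($1\le i\le n$) is an isomorphism of the induced finite structures; (4) for $A,A'\in\mathcal C$ and an isomorphism $\alpha\colon A\to A'$, the natural extension $\bar\alpha\colon E(A)\to E(A')$, given by $\alpha$ on $A$ and $\bar\alpha(x^\tau_i)=x^{\alpha(\tau)}_i$, is an isomorphism. $\mathrm{Aut}(M)$ is a Polish group; conjugacy: $\phi\sim\psi$ iff $\beta\phi\beta^{-1}=\psi$ for some $\beta\in\mathrm{Aut}(M)$. Borel reducibility: $E_1\le_B E_2$ if there is a Borel $f$ with $x\mathrel{E_1}x'\iff f(x)\mathrel{E_2}f(x')$. *)

theory Defs
  imports "HOL-Probability.Probability"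
begin

text \<open>A relational language is a (countable) type 'l of relation symbols together with
an arity function ar.  A (countable) structure is coded as a pair (D, R) with universe
D a subset of the naturals and R l xs meaning that relation l holds of the tuple xs.\<close>

type_synonym 'l struc = "nat set \<times> ('l \<Rightarrow> nat list \<Rightarrow> bool)"

definition sdom :: "'l struc \<Rightarrow> nat set" where "sdom S = fst S"
definition srel :: "'l struc \<Rightarrow> 'l \<Rightarrow> nat list \<Rightarrow> bool" where "srel S = snd S"

definition wf_struc :: "('l \<Rightarrow> nat) \<Rightarrow> 'l struc \<Rightarrow> bool" where
  "wf_struc ar S \<longleftrightarrow> (\<forall>l xs. srel S l xs \<longrightarrow> length xs = ar l \<and> set xs \<subseteq> sdom S)"

definition embedding :: "'l struc \<Rightarrow> 'l struc \<Rightarrow> (nat \<Rightarrow> nat) \<Rightarrow> bool" where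
  "embedding A B f \<longleftrightarrow> f ` sdom A \<subseteq> sdom B \<and> inj_on f (sdom A) \<and>
     (\<forall>l xs. set xs \<subseteq> sdom A \<longrightarrow> (srel A l xs \<longleftrightarrow> srel B l (map f xs)))"

definition isomorphism :: "'l struc \<Rightarrow> 'l struc \<Rightarrow> (nat \<Rightarrow> nat) \<Rightarrow> bool" where
  "isomorphism A B f \<longleftrightarrow> embedding A B f \<and> f ` sdom A = sdom B"

definition isomorphic :: "'l struc \<Rightarrow> 'l struc \<Rightarrow> bool" where
  "isomorphic A B \<longleftrightarrow> (\<exists>f. isomorphism A B f)"

definition induced :: "'l struc \<Rightarrow> nat set \<Rightarrow> 'l struc" where
  "induced S F = (F, \<lambda>l xs. srel S l xs \<and> set xs \<subseteq> F)"

definition K_omega :: "('l \<Rightarrow> nat) \<Rightarrow> 'l struc set \<Rightarrow> 'l struc set" where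
  "K_omega ar K = {A. wf_struc ar A \<and>
      (\<forall>F. finite F \<and> F \<subseteq> sdom A \<longrightarrow> (\<exists>B\<in>K. isomorphic (induced A F) B))}"

definition homogeneous :: "'l struc \<Rightarrow> bool" where
  "homogeneous M \<longleftrightarrow> (\<forall>F G f. finite F \<and> F \<subseteq> sdom M \<and> G \<subseteq> sdom M \<and>
      isomorphism (induced M F) (induced M G) f \<longrightarrow>
      (\<exists>g. isomorphism M M g \<and> (\<forall>x\<in>F. g x = f x)))"

text \<open>M is the Fraisse limit of K: a countable homogeneous structure in K_omega
into which every member of K embeds (so its finite substructures are exactly K,
up to isomorphism).\<close>
definition fraisse_limit :: "('l \<Rightarrow> nat) \<Rightarrow> 'l struc set \<Rightarrow> 'l struc \<Rightarrow> bool" where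
  "fraisse_limit ar K M \<longleftrightarrow> M \<in> K_omega ar K \<and> homogeneous M \<and>
      (\<forall>A\<in>K. \<exists>f. embedding A M f)"

definition SAP :: "'l struc set \<Rightarrow> bool" where
  "SAP C \<longleftrightarrow> (\<forall>A\<in>C. \<forall>B1\<in>C. \<forall>B2\<in>C. \<forall>g1 g2. embedding A B1 g1 \<and> embedding A B2 g2 \<longrightarrow>
     (\<exists>D\<in>C. \<exists>f1 f2. embedding B1 D f1 \<and> embedding B2 D f2 \<and>
        (\<forall>a\<in>sdom A. f1 (g1 a) = f2 (g2 a)) \<and>
        f1 ` sdom B1 \<inter> f2 ` sdom B2 = f1 ` g1 ` sdom A))"

text \<open>A quantifier-free type of a new element x over a finite set A0 is coded as (A0, P),
where P l ys says that relation l holds of the tuple obtained from ys by reading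
None as x and Some a as a.\<close>

type_synonym 'l qftype = "nat set \<times> ('l \<Rightarrow> nat option list \<Rightarrow> bool)"

definition is_qftype :: "('l \<Rightarrow> nat) \<Rightarrow> 'l struc \<Rightarrow> 'l qftype \<Rightarrow> bool" where
  "is_qftype ar A \<tau> \<longleftrightarrow> finite (fst \<tau>) \<and> fst \<tau> \<subseteq> sdom A \<and>
     (\<forall>l ys. snd \<tau> l ys \<longrightarrow> length ys = ar l \<and> set ys \<subseteq> insert None (Some ` fst \<tau>)) \<and>
     (\<forall>l xs. set xs \<subseteq> fst \<tau> \<longrightarrow> (snd \<tau> l (map Some xs) \<longleftrightarrow> srel A l xs))"

definition realizes :: "'l struc \<Rightarrow> (nat \<Rightarrow> nat) \<Rightarrow> 'l qftype \<Rightarrow> nat \<Rightarrow> bool" where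
  "realizes B e \<tau> b \<longleftrightarrow> b \<in> sdom B \<and> b \<notin> e ` fst \<tau> \<and>
     (\<forall>l ys. set ys \<subseteq> insert None (Some ` fst \<tau>) \<longrightarrow>
        (srel B l (map (\<lambda>y. case y of None \<Rightarrow> b | Some a \<Rightarrow> e a) ys) \<longleftrightarrow> snd \<tau> l ys))"

definition admissible :: "('l \<Rightarrow> nat) \<Rightarrow> 'l struc set \<Rightarrow> 'l struc \<Rightarrow> 'l qftype \<Rightarrow> bool" where
  "admissible ar C A \<tau> \<longleftrightarrow> is_qftype ar A \<tau> \<and>
     (\<exists>B\<in>C. \<exists>e b. embedding A B e \<and> realizes B e \<tau> b)"

text \<open>Image of a type under a map alpha (injective on its parameter set).\<close>
definition transport_type :: "(nat \<Rightarrow> nat) \<Rightarrow> 'l qftype \<Rightarrow> 'l qftype" where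
  "transport_type \<alpha> \<tau> = (\<alpha> ` fst \<tau>,
     \<lambda>l ys. \<exists>ys0. snd \<tau> l ys0 \<and> ys = map (map_option \<alpha>) ys0)"

text \<open>Borel sets of the Cantor space of codes of structures: generated by the basic
clopen sets.\<close>
definition struc_space :: "'l struc measure" where
  "struc_space = sigma UNIV
     ({{S. n \<in> sdom S} | n. True} \<union> {{S. srel S l xs} | l xs. True})"

definition baire_space :: "(nat \<Rightarrow> nat) measure" where
  "baire_space = sigma UNIV {{f. f k = m} | k m. True}"

definition borel_reducible ::
  "'a set \<Rightarrow> ('a \<Rightarrow> 'a \<Rightarrow> bool) \<Rightarrow> 'a measure \<Rightarrow> 'b set \<Rightarrow> ('b \<Rightarrow> 'b \<Rightarrow> bool) \<Rightarrow> 'b measure \<Rightarrow> bool"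
  where
  "borel_reducible X E MX Y F MY \<longleftrightarrow> (\<exists>f. f \<in> measurable (restrict_space MX X) MY \<and>
     (\<forall>x\<in>X. f x \<in> Y) \<and> (\<forall>x\<in>X. \<forall>x'\<in>X. E x x' \<longleftrightarrow> F (f x) (f x')))"

text \<open>E A is the extension; iota A embeds A into E A (identifying A with a substructure);
w A tau i is the witness x^tau_i, for i in 1..n.\<close>

definition cyc_next :: "nat \<Rightarrow> nat \<Rightarrow> nat" where
  "cyc_next n i = (if i = n then 1 else i + 1)"

definition BAP :: "nat \<Rightarrow> ('l \<Rightarrow> nat) \<Rightarrow> 'l struc set \<Rightarrow> bool" where
  "BAP n ar C \<longleftrightarrow> SAP C \<and>
   (\<exists>(E :: 'l struc \<Rightarrow> 'l struc) (\<iota> :: 'l struc \<Rightarrow> nat \<Rightarrow> nat)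
       (w :: 'l struc \<Rightarrow> 'l qftype \<Rightarrow> nat \<Rightarrow> nat).
     \<comment> \<open>Borel assignment\<close>
     E \<in> measurable (restrict_space struc_space C) struc_space \<and>
     (\<forall>a. (\<lambda>A. \<iota> A a) \<in> measurable (restrict_space struc_space C) (count_space UNIV)) \<and>
     (\<forall>\<tau> i. (\<lambda>A. w A \<tau> i) \<in> measurable (restrict_space struc_space C) (count_space UNIV)) \<and>
     (\<forall>A\<in>C. E A \<in> C) \<and>
     \<comment> \<open>(1) E A consists of (a copy of) A together with n witnesses for each admissible type\<close>
     (\<forall>A\<in>C.
        embedding A (E A) (\<iota> A) \<and>
        sdom (E A) = \<iota> A ` sdom A \<union> {w A \<tau> i | \<tau> i. admissible ar C A \<tau> \<and> i \<in> {1..n}} \<and>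
        \<iota> A ` sdom A \<inter> {w A \<tau> i | \<tau> i. admissible ar C A \<tau> \<and> i \<in> {1..n}} = {} \<and>
        inj_on (\<lambda>(\<tau>, i). w A \<tau> i) {(\<tau>, i). admissible ar C A \<tau> \<and> i \<in> {1..n}} \<and>
        (\<forall>\<tau> i. admissible ar C A \<tau> \<and> i \<in> {1..n} \<longrightarrow> realizes (E A) (\<iota> A) \<tau> (w A \<tau> i))) \<and>
     \<comment> \<open>(2) a cyclic automorphism fixing A pointwise\<close>
     (\<forall>A\<in>C. \<exists>\<sigma>. isomorphism (E A) (E A) \<sigma> \<and> (\<forall>a\<in>sdom A. \<sigma> (\<iota> A a) = \<iota> A a) \<and>
        (\<forall>\<tau> i. admissible ar C A \<tau> \<and> i \<in> {1..n} \<longrightarrow> \<sigma> (w A \<tau> i) = w A \<tau> (cyc_next n i))) \<and>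
     \<comment> \<open>(3) witness tuples of different types look alike\<close>
     (\<forall>A\<in>C. \<forall>\<tau> \<tau>'. admissible ar C A \<tau> \<and> admissible ar C A \<tau>' \<longrightarrow>
        (\<exists>f. isomorphism (induced (E A) (w A \<tau> ` {1..n})) (induced (E A) (w A \<tau>' ` {1..n})) f \<and>
             (\<forall>i\<in>{1..n}. f (w A \<tau> i) = w A \<tau>' i))) \<and>
     \<comment> \<open>(4) naturality with respect to isomorphisms\<close>
     (\<forall>A\<in>C. \<forall>A'\<in>C. \<forall>\<alpha>. isomorphism A A' \<alpha> \<longrightarrow>
        (\<exists>\<beta>. isomorphism (E A) (E A') \<beta> \<and>
             (\<forall>a\<in>sdom A. \<beta> (\<iota> A a) = \<iota> A' (\<alpha> a)) \<and>
             (\<forall>\<tau> i. admissible ar C A \<tau> \<and> i \<in> {1..n} \<longrightarrow>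
                \<beta> (w A \<tau> i) = w A' (transport_type \<alpha> \<tau>) i))))"

text \<open>Aut(M), with automorphisms normalised to be the identity off the universe of M,
viewed as a subspace of the Baire space.\<close>
definition Aut :: "'l struc \<Rightarrow> (nat \<Rightarrow> nat) set" where
  "Aut M = {g. isomorphism M M g \<and> (\<forall>x. x \<notin> sdom M \<longrightarrow> g x = x)}"

text \<open>phi ~ psi iff beta phi beta^-1 = psi for some beta in Aut(M), i.e. beta o phi = psi o beta.\<close>
definition conjugate :: "'l struc \<Rightarrow> (nat \<Rightarrow> nat) \<Rightarrow> (nat \<Rightarrow> nat) \<Rightarrow> bool" where
  "conjugate M \<phi> \<psi> \<longleftrightarrow> (\<exists>\<beta>\<in>Aut M. \<forall>x\<in>sdom M. \<beta> (\<phi> x) = \<psi> (\<beta> x))"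

end

theory Submission
  imports Defs
begin

text \<open>Starting from A, iterate the amalgamation functor E and let W A be the union of the chain
  of the stages. Every one-point type over a finite part of a stage that is consistent with the
  class is realized at the next stage, so back-and-forth identifies W A with M.
  Along the chain, naturality extends an automorphism of one stage to the next; composing with the
  cyclic automorphism that rotates the n witnesses of each type moves every new point, because
  n \<ge> 2. The resulting automorphism of W A has A as its set of fixed points, so its conjugacy
  class determines A up to isomorphism, and by naturality an isomorphism of A with A' extends to
  one of W A with W A' that commutes with these automorphisms.

  For measurability, all choices are made explicit: elements of W A are coded by stage and name,
  back-and-forth picks least witnesses, and only countably many types ever occur, since each is
  read off from M.\<close>

section \<open>Embeddings and partial isomorphisms\<close>

text \<open>Two obstacles shape the proof. Admissibility of a type over A quantifies over all
  extensions of A in an uncountable class, so it is not visibly a Borel condition on A. Strong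
  amalgamation removes this quantifier: a type is admissible iff its restriction to the parameters
  agrees with A and it is the type of some element of M over a copy of its parameters. The second
  condition does not mention A, and the first is a countable conjunction. Moreover,
  \<open>BAP\<close> only asserts that cyclic and natural maps exist, and it makes the witness
  measurable only for a type that is held fixed. Since A and the witnesses exhaust the universe of
  \<open>E A\<close>, those maps are forced there and can be replaced by one explicit formula
  \<open>ext\<close>, in which isomorphisms act on the type and the rotation acts on the index; this
  is why the two commute. The transported type does vary with A, so the finitely many values of the
  automorphism that it uses are guessed by a finite table. Only half of the back-and-forth needs the
  witnesses: mapping a member of the class forward into M follows from homogeneity alone.\<close>

lemma sdom_induced [simp]: "sdom (induced S F) = F"
  by (simp add: induced_def sdom_def)

lemma srel_induced [simp]: "srel (induced S F) l xs \<longleftrightarrow> srel S l xs \<and> set xs \<subseteq> F"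
  by (simp add: induced_def srel_def)

lemma embedding_cong:
  assumes "embedding A B f" "\<And>x. x \<in> sdom A \<Longrightarrow> f x = g x"
  shows "embedding A B g"
proof -
  have "map f xs = map g xs" if "set xs \<subseteq> sdom A" for xs
    using that assms(2) by (auto intro!: map_cong)
  with assms show ?thesis
    by (auto simp: embedding_def inj_on_def subset_iff image_subset_iff)
qed

lemma isomorphism_cong:
  assumes "isomorphism A B f" "\<And>x. x \<in> sdom A \<Longrightarrow> f x = g x"
  shows "isomorphism A B g"
  using assms embedding_cong[of A B f g] by (simp add: isomorphism_def)

lemma embedding_comp:
  assumes "embedding A B f" "embedding B C g"
  shows "embedding A C (g \<circ> f)"
proof -
  have sub: "f ` sdom A \<subseteq> sdom B" and sub2: "g ` sdom B \<subseteq> sdom C"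
    using assms by (auto simp: embedding_def)
  have "inj_on (g \<circ> f) (sdom A)"
    using assms sub by (auto simp: embedding_def intro: comp_inj_on inj_on_subset)
  moreover have "srel A l xs \<longleftrightarrow> srel C l (map (g \<circ> f) xs)" if "set xs \<subseteq> sdom A" for l xs
  proof -
    have "set (map f xs) \<subseteq> sdom B" using that sub by auto
    then have "srel B l (map f xs) \<longleftrightarrow> srel C l (map g (map f xs))"
      using assms(2) unfolding embedding_def by blast
    with that assms(1) show ?thesis by (simp add: embedding_def)
  qed
  moreover have "(g \<circ> f) ` sdom A \<subseteq> sdom C" using sub sub2 by fastforce
  ultimately show ?thesis unfolding embedding_def by blast
qed

lemma isomorphism_comp:
  assumes "isomorphism A B f" "isomorphism B C g"
  shows "isomorphism A C (g \<circ> f)"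
proof -
  have "(g \<circ> f) ` sdom A = sdom C"
    using assms by (metis image_comp isomorphism_def)
  with assms embedding_comp[of A B f C g] show ?thesis by (simp add: isomorphism_def)
qed

lemma embedding_id: "embedding A A id"
  by (simp add: embedding_def)

lemma isomorphism_id: "isomorphism A A id"
  by (simp add: isomorphism_def embedding_id)

lemma embedding_of_induced:
  assumes "embedding A B f" "F \<subseteq> sdom A"
  shows "embedding (induced A F) B f"
  using assms by (auto simp: embedding_def inj_on_def subset_iff image_subset_iff)

lemma isomorphism_onto_image:
  assumes "embedding A B f"
  shows "isomorphism A (induced B (f ` sdom A)) f"
  using assms by (auto simp: isomorphism_def embedding_def)

lemma isomorphism_induced:
  assumes "embedding A B f" "F \<subseteq> sdom A"
  shows "isomorphism (induced A F) (induced B (f ` F)) f"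
  using isomorphism_onto_image[OF embedding_of_induced[OF assms]] by simp

lemma isomorphism_inv_into:
  assumes "isomorphism A B f"
  shows "isomorphism B A (inv_into (sdom A) f)"
proof -
  let ?g = "inv_into (sdom A) f"
  have im: "f ` sdom A = sdom B" and inj: "inj_on f (sdom A)"
    using assms by (auto simp: isomorphism_def embedding_def)
  have gim: "?g ` sdom B = sdom A"
    using im inj by (metis inv_into_image_cancel subset_refl)
  have "srel B l xs \<longleftrightarrow> srel A l (map ?g xs)" if "set xs \<subseteq> sdom B" for l xs
  proof -
    have "set (map ?g xs) \<subseteq> sdom A" using gim that by auto
    then have "srel A l (map ?g xs) \<longleftrightarrow> srel B l (map f (map ?g xs))"
      using assms unfolding isomorphism_def embedding_def by blast
    moreover have "map f (map ?g xs) = xs"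
      using that im by (auto intro!: map_idI simp: f_inv_into_f subset_iff)
    ultimately show ?thesis by simp
  qed
  with gim im show ?thesis
    by (auto simp: isomorphism_def embedding_def inj_on_inv_into)
qed

lemma isomorphism_in: "isomorphism A B f \<Longrightarrow> x \<in> sdom A \<Longrightarrow> f x \<in> sdom B"
  by (auto simp: isomorphism_def)

text \<open>Well-formedness of A is a separate hypothesis because \<open>embedding\<close> says
  nothing about tuples that leave the universe of A.\<close>

lemma K_omega_embedding:
  assumes "embedding A B f" "B \<in> K_omega ar K" "wf_struc ar A"
  shows "A \<in> K_omega ar K"
proof -
  have "\<exists>D\<in>K. isomorphic (induced A F) D" if F: "finite F" "F \<subseteq> sdom A" for F
  proof -
    have "f ` F \<subseteq> sdom B" using assms(1) F by (auto simp: embedding_def)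
    with assms(2) F obtain D g where D: "D \<in> K" "isomorphism (induced B (f ` F)) D g"
      unfolding K_omega_def isomorphic_def by blast
    from isomorphism_comp[OF isomorphism_induced[OF assms(1) F(2)] D(2)] D(1)
    show ?thesis unfolding isomorphic_def by blast
  qed
  with assms(3) show ?thesis by (simp add: K_omega_def)
qed

lemma K_omega_induced:
  assumes "A \<in> K_omega ar K" "F \<subseteq> sdom A"
  shows "induced A F \<in> K_omega ar K"
proof (rule K_omega_embedding)
  show "embedding (induced A F) A id"
    using embedding_of_induced[OF embedding_id assms(2)] .
  show "wf_struc ar (induced A F)"
    using assms(1) by (simp add: K_omega_def wf_struc_def)
qed (use assms in auto)

text \<open>Sets of pairs are used instead of functions with a domain: finite ones are listed by a
  countable type, and extension is just \<open>insert\<close>. The equivalence of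
  \<open>fst a = fst b\<close> and \<open>snd a = snd b\<close> expresses single-valuedness and
  injectivity together.\<close>

definition partial_iso :: "'l struc \<Rightarrow> 'l struc \<Rightarrow> (nat \<times> nat) set \<Rightarrow> bool" where
  "partial_iso S T p \<longleftrightarrow> fst ` p \<subseteq> sdom S \<and> snd ` p \<subseteq> sdom T \<and>
     (\<forall>a\<in>p. \<forall>b\<in>p. fst a = fst b \<longleftrightarrow> snd a = snd b) \<and>
     (\<forall>l zs. set zs \<subseteq> p \<longrightarrow> (srel S l (map fst zs) \<longleftrightarrow> srel T l (map snd zs)))"

lemma partial_iso_graph:
  assumes "embedding (induced S F) T f" "F \<subseteq> sdom S"
  shows "partial_iso S T ((\<lambda>x. (x, f x)) ` F)"
proof -
  have "srel S l (map fst zs) \<longleftrightarrow> srel T l (map snd zs)"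
    if "set zs \<subseteq> (\<lambda>x. (x, f x)) ` F" for l zs
  proof -
    have eq: "map snd zs = map f (map fst zs)" and F: "set (map fst zs) \<subseteq> F"
      using that by auto
    have "srel (induced S F) l (map fst zs) \<longleftrightarrow> srel T l (map f (map fst zs))"
      using assms(1) F unfolding embedding_def sdom_induced by blast
    with F show ?thesis unfolding eq by simp
  qed
  with assms show ?thesis
    by (auto simp: partial_iso_def embedding_def inj_on_def)
qed

text \<open>Homogeneity is stated for functions, so the set of pairs has to be turned back into
  one.\<close>

lemma partial_iso_mapE:
  assumes "partial_iso S T p"
  obtains f where "embedding (induced S (fst ` p)) T f" "\<And>x y. (x, y) \<in> p \<Longrightarrow> f x = y"
    "p = (\<lambda>x. (x, f x)) ` fst ` p"
proof -
  define f where "f x = (THE y. (x, y) \<in> p)" for x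
  have f: "f x = y" if "(x, y) \<in> p" for x y
    unfolding f_def
  proof (rule the_equality)
    fix y' assume "(x, y') \<in> p"
    with that assms show "y' = y"
      unfolding partial_iso_def by (metis fst_conv snd_conv)
  qed (use that in auto)
  have p: "p = (\<lambda>x. (x, f x)) ` fst ` p"
    using f by (force simp: image_iff)
  have "srel S l xs \<longleftrightarrow> srel T l (map f xs)" if "set xs \<subseteq> fst ` p" for l xs
  proof -
    have "set (map (\<lambda>x. (x, f x)) xs) \<subseteq> p" using that f by fastforce
    then have "srel S l (map fst (map (\<lambda>x. (x, f x)) xs)) \<longleftrightarrow>
        srel T l (map snd (map (\<lambda>x. (x, f x)) xs))"
      using assms unfolding partial_iso_def by blast
    then show ?thesis by (simp add: comp_def)
  qed
  moreover have "inj_on f (fst ` p)"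
  proof (rule inj_onI)
    fix x y assume "x \<in> fst ` p" "y \<in> fst ` p" "f x = f y"
    then have "(x, f x) \<in> p" "(y, f y) \<in> p" using f by force+
    with \<open>f x = f y\<close> assms show "x = y"
      unfolding partial_iso_def by (metis fst_conv snd_conv)
  qed
  moreover have "f ` fst ` p \<subseteq> sdom T"
  proof clarify
    fix x y assume "(x, y) \<in> p"
    then have "snd (x, y) \<in> sdom T" using assms unfolding partial_iso_def by blast
    with f[OF \<open>(x, y) \<in> p\<close>] show "f (fst (x, y)) \<in> sdom T" by simp
  qed
  ultimately have "embedding (induced S (fst ` p)) T f"
    by (auto simp: embedding_def)
  from this f p show ?thesis by (rule that)
qed

text \<open>Each clause of \<open>partial_iso\<close> involves only finitely many pairs, and these
  already lie in one member of the chain.\<close>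

lemma partial_iso_Union_chain:
  assumes "\<And>k. partial_iso S T (p k)" "incseq p"
  shows "partial_iso S T (\<Union>k. p k)"
proof -
  have fin: "\<exists>k. F \<subseteq> p k" if "finite F" "F \<subseteq> (\<Union>k. p k)" for F
    using that
  proof (induction F rule: finite_induct)
    case (insert x F)
    then obtain k k' where "F \<subseteq> p k" "x \<in> p k'" by auto
    then have "insert x F \<subseteq> p (max k k')"
      using incseqD[OF assms(2), of k "max k k'"] incseqD[OF assms(2), of k' "max k k'"] by auto
    then show ?case by blast
  qed auto
  have "fst a = fst b \<longleftrightarrow> snd a = snd b" if "a \<in> (\<Union>k. p k)" "b \<in> (\<Union>k. p k)" for a b
    using fin[of "{a, b}"] that assms(1) unfolding partial_iso_def
    by (metis bot.extremum finite.emptyI finite.insertI insert_subset)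
  moreover have "srel S l (map fst zs) \<longleftrightarrow> srel T l (map snd zs)"
    if "set zs \<subseteq> (\<Union>k. p k)" for l zs
    using fin[of "set zs"] that assms(1) unfolding partial_iso_def by blast
  moreover have "fst ` (\<Union>k. p k) \<subseteq> sdom S" "snd ` (\<Union>k. p k) \<subseteq> sdom T"
    using assms(1) by (force simp: partial_iso_def)+
  ultimately show ?thesis by (simp add: partial_iso_def)
qed

lemma partial_iso_total:
  assumes "partial_iso S T p" "fst ` p = sdom S" "snd ` p = sdom T"
  obtains f where "isomorphism S T f" "\<And>x y. x \<in> sdom S \<Longrightarrow> f x = y \<longleftrightarrow> (x, y) \<in> p"
proof -
  from assms(1) obtain f where f: "embedding (induced S (fst ` p)) T f"
    "\<And>x y. (x, y) \<in> p \<Longrightarrow> f x = y" "p = (\<lambda>x. (x, f x)) ` fst ` p"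
    by (rule partial_iso_mapE) blast
  have "f ` sdom S = sdom T" using f(2) assms(2,3) by force
  then have "isomorphism S T f"
    using f(1) assms(2) by (auto simp: isomorphism_def embedding_def)
  moreover have "f x = y \<longleftrightarrow> (x, y) \<in> p" if "x \<in> sdom S" for x y
    using f(2) that assms(2) by force
  ultimately show ?thesis using that by blast
qed

section \<open>Back and forth\<close>

lemma fraisse_limit_age:
  assumes M: "fraisse_limit ar K M" and A: "A \<in> K_omega ar K" and F: "finite F" "F \<subseteq> sdom A"
  obtains e where "embedding (induced A F) M e"
proof -
  from A F obtain B b where B: "B \<in> K" "isomorphism (induced A F) B b"
    unfolding K_omega_def isomorphic_def by blast
  from M B(1) obtain c where "embedding B M c" unfolding fraisse_limit_def by blast
  with B(2) have "embedding (induced A F) M (c \<circ> b)"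
    by (auto simp: isomorphism_def intro: embedding_comp)
  then show ?thesis by (rule that)
qed

text \<open>The finite set \<open>insert x F\<close> embeds into M by some \<open>e\<close>, but not
  necessarily extending p. Both \<open>e\<close> and the map \<open>f\<close> of p embed F, so
  homogeneity gives an automorphism \<open>g\<close> of M taking \<open>e\<close> to
  \<open>f\<close> on F, and \<open>g \<circ> e\<close> extends p.\<close>

lemma fraisse_limit_forth:
  assumes M: "fraisse_limit ar K M" and A: "A \<in> K_omega ar K"
    and p: "partial_iso A M p" "finite p" and x: "x \<in> sdom A"
  shows "\<exists>y. partial_iso A M (insert (x, y) p)"
proof -
  define F where "F = fst ` p"
  from p(1) obtain f where f: "embedding (induced A F) M f" "p = (\<lambda>x. (x, f x)) ` F"
    unfolding F_def by (rule partial_iso_mapE)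
  have F: "finite F" "F \<subseteq> sdom A" using p by (auto simp: F_def partial_iso_def)
  then have iF: "finite (insert x F)" "insert x F \<subseteq> sdom A" using x by auto
  from fraisse_limit_age[OF M A iF]
  obtain e where e: "embedding (induced A (insert x F)) M e" .
  have eF: "embedding (induced A F) M e"
    using e by (auto simp: embedding_def inj_on_def subset_iff)
  have "isomorphism (induced M (e ` F)) (induced M (f ` F)) (f \<circ> inv_into F e)"
    using isomorphism_comp[OF isomorphism_inv_into[OF isomorphism_onto_image[OF eF]]
      isomorphism_onto_image[OF f(1)]] by simp
  moreover have "e ` F \<subseteq> sdom M" "f ` F \<subseteq> sdom M" "finite (e ` F)"
    using eF f(1) F(1) by (auto simp: embedding_def)
  ultimately obtain g where g: "isomorphism M M g" "\<And>z. z \<in> e ` F \<Longrightarrow> g z = (f \<circ> inv_into F e) z"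
    using M unfolding fraisse_limit_def homogeneous_def by metis
  have gf: "g (e z) = f z" if "z \<in> F" for z
  proof -
    have "inv_into F e (e z) = z"
      using that eF by (intro inv_into_f_f) (auto simp: embedding_def)
    with g(2)[of "e z"] that show ?thesis by auto
  qed
  have "embedding (induced A (insert x F)) M (g \<circ> e)"
    using e g(1) by (auto simp: isomorphism_def intro: embedding_comp)
  then have "partial_iso A M ((\<lambda>z. (z, (g \<circ> e) z)) ` insert x F)"
    using iF(2) by (rule partial_iso_graph)
  moreover have "(\<lambda>z. (z, (g \<circ> e) z)) ` insert x F = insert (x, g (e x)) p"
    using gf f(2) by (auto simp: image_iff)
  ultimately show ?thesis by metis
qed

text \<open>The back half of back-and-forth. Membership in the class does not provide it; the
  witnesses added by the functor do.\<close>

definition ext_prop :: "'l struc \<Rightarrow> 'l struc \<Rightarrow> bool" where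
  "ext_prop M S \<longleftrightarrow> (\<forall>p y. finite p \<and> partial_iso S M p \<and> y \<in> sdom M \<longrightarrow>
     (\<exists>x. partial_iso S M (insert (x, y) p)))"

text \<open>\<open>LEAST\<close> in place of an arbitrary choice makes the step a Borel function of
  S. If k already has a partner, that partner is the only candidate and its pair is merely
  repeated.\<close>

definition forth_step :: "'l struc \<Rightarrow> 'l struc \<Rightarrow> nat \<Rightarrow> (nat \<times> nat) list \<Rightarrow> (nat \<times> nat) list" where
  "forth_step M S k p =
     (if k \<in> sdom S then (k, LEAST y. partial_iso S M (set ((k, y) # p))) # p else p)"

definition back_step :: "'l struc \<Rightarrow> 'l struc \<Rightarrow> nat \<Rightarrow> (nat \<times> nat) list \<Rightarrow> (nat \<times> nat) list" where
  "back_step M S k p =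
     (if k \<in> sdom M then (LEAST x. partial_iso S M (set ((x, k) # p)), k) # p else p)"

primrec back_forth :: "'l struc \<Rightarrow> 'l struc \<Rightarrow> nat \<Rightarrow> (nat \<times> nat) list" where
  "back_forth M S 0 = []"
| "back_forth M S (Suc k) = back_step M S k (forth_step M S k (back_forth M S k))"

definition bf_map :: "'l struc \<Rightarrow> 'l struc \<Rightarrow> nat \<Rightarrow> nat" where
  "bf_map M S x = (THE y. \<exists>k. (x, y) \<in> set (back_forth M S k))"

text \<open>The second claim presents the graph of \<open>bf_map\<close> as a countable union of
  finite approximations; this is the form in which its measurability is established.\<close>

lemma back_forth_isomorphism:
  assumes M: "fraisse_limit ar K M" and S: "S \<in> K_omega ar K" "ext_prop M S"
  shows "isomorphism S M (bf_map M S)"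
    and "\<And>x y. (\<exists>k. (x, y) \<in> set (back_forth M S k)) \<longleftrightarrow> x \<in> sdom S \<and> bf_map M S x = y"
proof -
  let ?p = "back_forth M S"
  \<comment> \<open>Not vacuous: the empty tuple must satisfy the same nullary relations in S and M,
    which follows from embedding the empty substructure of S into M.\<close>
  have empty: "partial_iso S M {}"
  proof -
    from fraisse_limit_age[OF M S(1), of "{}"]
    obtain e where "embedding (induced S {}) M e" by auto
    from partial_iso_graph[OF this] show ?thesis by simp
  qed
  have forth_step: "partial_iso S M (set (forth_step M S k p))" if p: "partial_iso S M (set p)" for p k
  proof (cases "k \<in> sdom S")
    case True
    have "\<exists>y. partial_iso S M (set ((k, y) # p))"
      using fraisse_limit_forth[OF M S(1) p _ True] by simp
    then have "partial_iso S M (set ((k, LEAST y. partial_iso S M (set ((k, y) # p))) # p))"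
      by (rule LeastI_ex)
    with True show ?thesis by (simp add: forth_step_def)
  qed (simp add: forth_step_def p)
  have back_step: "partial_iso S M (set (back_step M S k p))" if p: "partial_iso S M (set p)" for p k
  proof (cases "k \<in> sdom M")
    case True
    have "\<exists>x. partial_iso S M (set ((x, k) # p))"
      using S(2) p True unfolding ext_prop_def by simp
    then have "partial_iso S M (set ((LEAST x. partial_iso S M (set ((x, k) # p)), k) # p))"
      by (rule LeastI_ex)
    with True show ?thesis by (simp add: back_step_def)
  qed (simp add: back_step_def p)
  have part: "partial_iso S M (set (?p k))" for k
    by (induction k) (simp_all add: empty forth_step back_step)
  have inc: "incseq (\<lambda>k. set (?p k))"
    by (rule incseq_SucI) (auto simp: back_step_def forth_step_def)
  define H where "H = (\<Union>k. set (?p k))"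
  have H: "partial_iso S M H"
    unfolding H_def using part inc by (rule partial_iso_Union_chain)
  have "x \<in> fst ` H" if "x \<in> sdom S" for x
  proof -
    \<comment> \<open>Step number x treats the element x, so x is in the domain from
      \<open>Suc x\<close> on.\<close>
    have "x \<in> fst ` set (?p (Suc x))" using that by (auto simp: back_step_def forth_step_def)
    then show ?thesis unfolding H_def by (metis UN_upper UNIV_I image_mono subsetD)
  qed
  then have domH: "fst ` H = sdom S"
    using H by (auto simp: partial_iso_def)
  have "y \<in> snd ` H" if "y \<in> sdom M" for y
  proof -
    have "y \<in> snd ` set (?p (Suc y))" using that by (auto simp: back_step_def forth_step_def)
    then show ?thesis unfolding H_def by (metis UN_upper UNIV_I image_mono subsetD)
  qed
  then have ranH: "snd ` H = sdom M"
    using H by (auto simp: partial_iso_def)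
  obtain f where f: "isomorphism S M f" "\<And>x y. x \<in> sdom S \<Longrightarrow> f x = y \<longleftrightarrow> (x, y) \<in> H"
    using partial_iso_total[OF H domH ranH] by metis
  have eq: "f x = bf_map M S x" if "x \<in> sdom S" for x
  proof -
    have "bf_map M S x = (THE y. (x, y) \<in> H)" by (simp add: bf_map_def H_def)
    also have "\<dots> = f x" by (rule the_equality) (metis f(2) that)+
    finally show ?thesis by simp
  qed
  show "isomorphism S M (bf_map M S)" using isomorphism_cong[OF f(1) eq] .
  show "(\<exists>k. (x, y) \<in> set (?p k)) \<longleftrightarrow> x \<in> sdom S \<and> bf_map M S x = y" for x y
  proof -
    have "(\<exists>k. (x, y) \<in> set (?p k)) \<longleftrightarrow> (x, y) \<in> H" by (simp add: H_def)
    moreover have "(x, y) \<in> H \<Longrightarrow> x \<in> sdom S" using domH by force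
    ultimately show ?thesis using f(2) eq by metis
  qed
qed

section \<open>Measurability of the back-and-forth construction\<close>

lemma space_struc_space [simp]: "space struc_space = UNIV"
  by (simp add: struc_space_def)

lemma pred_sdom:
  assumes "f \<in> measurable X struc_space"
  shows "Measurable.pred X (\<lambda>a. x \<in> sdom (f a))"
proof -
  have "{S. x \<in> sdom S} \<in> sets struc_space"
    unfolding struc_space_def by (subst sets_measure_of) auto
  from measurable_sets[OF assms this] show ?thesis
    by (simp add: pred_def vimage_def Int_def conj_commute)
qed

lemma pred_srel:
  assumes "f \<in> measurable X struc_space"
  shows "Measurable.pred X (\<lambda>a. srel (f a) l xs)"
proof -
  have "{S. srel S l xs} \<in> sets struc_space"
    unfolding struc_space_def by (subst sets_measure_of) auto
  from measurable_sets[OF assms this] show ?thesis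
    by (simp add: pred_def vimage_def Int_def conj_commute)
qed

lemma measurable_struc_spaceI:
  fixes f :: "'a \<Rightarrow> 'l struc"
  assumes "\<And>x. Measurable.pred X (\<lambda>a. x \<in> sdom (f a))"
    and "\<And>l xs. Measurable.pred X (\<lambda>a. srel (f a) l xs)"
  shows "f \<in> measurable X struc_space"
  unfolding struc_space_def
proof (rule measurable_measure_of)
  fix Y :: "'l struc set" assume "Y \<in> {{S. n \<in> sdom S} | n. True} \<union> {{S. srel S l xs} | l xs. True}"
  then show "f -` Y \<inter> space X \<in> sets X"
    using assms by (auto simp: pred_def vimage_def Int_def conj_commute)
qed auto

lemma measurable_baire_spaceI:
  assumes "\<And>k m. Measurable.pred X (\<lambda>a. f a k = m)"
  shows "f \<in> measurable X baire_space"
  unfolding baire_space_def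
proof (rule measurable_measure_of)
  fix Y :: "(nat \<Rightarrow> nat) set" assume "Y \<in> {{f. f k = m} | k m. True}"
  then show "f -` Y \<inter> space X \<in> sets X"
    using assms by (auto simp: pred_def vimage_def Int_def conj_commute)
qed auto

text \<open>With p finite and fixed, the statement is a countable conjunction of generator
  conditions, because both the language and the lists of pairs are countable.\<close>

lemma pred_partial_iso:
  fixes f :: "'a \<Rightarrow> 'l::countable struc"
  assumes "f \<in> measurable X struc_space"
  shows "Measurable.pred X (\<lambda>a. partial_iso (f a) M (set p))"
proof -
  have eq: "partial_iso S M (set p) \<longleftrightarrow> (\<forall>z\<in>set p. fst z \<in> sdom S) \<and> snd ` set p \<subseteq> sdom M \<and>
     (\<forall>a\<in>set p. \<forall>b\<in>set p. fst a = fst b \<longleftrightarrow> snd a = snd b) \<and>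
     (\<forall>l zs. set zs \<subseteq> set p \<longrightarrow> (srel S l (map fst zs) \<longleftrightarrow> srel M l (map snd zs)))" for S
    by (auto simp: partial_iso_def)
  show ?thesis unfolding eq
    by (intro pred_intros_logic pred_intros_countable pred_intros_countable_bounded
      pred_sdom[OF assms] pred_srel[OF assms] measurable_count_space_const)
qed

text \<open>The approximations are lists over a countable type, so it suffices to treat each step
  for a fixed list p and then glue over the countably many values of p.\<close>

lemma measurable_back_forth:
  fixes f :: "'a \<Rightarrow> 'l::countable struc"
  assumes f: "f \<in> measurable X struc_space"
  shows "(\<lambda>a. back_forth M (f a) k) \<in> measurable X (count_space UNIV)"
proof (induction k)
  case (Suc k)
  have "(\<lambda>a. forth_step M (f a) k p) \<in> measurable X (count_space UNIV)" for p
  proof -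
    have "(\<lambda>a. LEAST y. partial_iso (f a) M (set ((k, y) # p))) \<in> measurable X (count_space UNIV)"
      by (rule measurable_Least) (rule pred_partial_iso[OF f])
    then have "(\<lambda>a. (k, LEAST y. partial_iso (f a) M (set ((k, y) # p))) # p)
        \<in> measurable X (count_space UNIV)"
      by (rule measurable_compose[where g = "\<lambda>y. (k, y) # p"]) simp
    then show ?thesis
      unfolding forth_step_def using pred_sdom[OF f]
      by (intro measurable_If) (auto simp: pred_def)
  qed
  then have 1: "(\<lambda>a. forth_step M (f a) k (back_forth M (f a) k)) \<in> measurable X (count_space UNIV)"
    using Suc.IH by (rule measurable_compose_countable)
  have "(\<lambda>a. back_step M (f a) k p) \<in> measurable X (count_space UNIV)" for p
  proof -
    have "(\<lambda>a. LEAST x. partial_iso (f a) M (set ((x, k) # p))) \<in> measurable X (count_space UNIV)"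
      by (rule measurable_Least) (rule pred_partial_iso[OF f])
    then have "(\<lambda>a. (LEAST x. partial_iso (f a) M (set ((x, k) # p)), k) # p)
        \<in> measurable X (count_space UNIV)"
      by (rule measurable_compose[where g = "\<lambda>x. (x, k) # p"]) simp
    then show ?thesis
      unfolding back_step_def by (cases "k \<in> sdom M") auto
  qed
  from this 1
  have "(\<lambda>a. back_step M (f a) k (forth_step M (f a) k (back_forth M (f a) k)))
      \<in> measurable X (count_space UNIV)"
    by (rule measurable_compose_countable)
  then show ?case by simp
qed simp

lemma pred_back_forth:
  fixes f :: "'a \<Rightarrow> 'l::countable struc"
  assumes f: "f \<in> measurable X struc_space"
  shows "Measurable.pred X (\<lambda>a. \<exists>k. (x, y) \<in> set (back_forth M (f a) k))"
  by (intro pred_intros_countable measurable_compose[OF measurable_back_forth[OF f]]) simp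

section \<open>Limits of chains of embeddings\<close>

text \<open>An element of the limit is coded by the first stage at which it appears together with
  its name at that stage.\<close>

primrec chain_code :: "(nat \<Rightarrow> 'l struc) \<Rightarrow> (nat \<Rightarrow> nat \<Rightarrow> nat) \<Rightarrow> nat \<Rightarrow> nat \<Rightarrow> nat" where
  "chain_code S j 0 = (\<lambda>x. prod_encode (0, x))"
| "chain_code S j (Suc m) = (\<lambda>y. if y \<in> j m ` sdom (S m)
     then chain_code S j m (inv_into (sdom (S m)) (j m) y) else prod_encode (Suc m, y))"

definition chain_limit :: "(nat \<Rightarrow> 'l struc) \<Rightarrow> (nat \<Rightarrow> nat \<Rightarrow> nat) \<Rightarrow> 'l struc" where
  "chain_limit S j = (\<Union>m. chain_code S j m ` sdom (S m),
     \<lambda>l xs. \<exists>m ys. set ys \<subseteq> sdom (S m) \<and> xs = map (chain_code S j m) ys \<and> srel (S m) l ys)"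

lemma sdom_chain_limit: "sdom (chain_limit S j) = (\<Union>m. chain_code S j m ` sdom (S m))"
  by (simp add: chain_limit_def sdom_def)

lemma srel_chain_limit: "srel (chain_limit S j) l xs \<longleftrightarrow>
    (\<exists>m ys. set ys \<subseteq> sdom (S m) \<and> xs = map (chain_code S j m) ys \<and> srel (S m) l ys)"
  by (simp add: chain_limit_def srel_def)

locale chain =
  fixes S :: "nat \<Rightarrow> 'l struc" and j :: "nat \<Rightarrow> nat \<Rightarrow> nat"
  assumes emb: "embedding (S m) (S (Suc m)) (j m)"
begin

abbreviation "code \<equiv> chain_code S j"
abbreviation "L \<equiv> chain_limit S j"

lemma j_dom: "x \<in> sdom (S m) \<Longrightarrow> j m x \<in> sdom (S (Suc m))"
  using emb[of m] by (auto simp: embedding_def)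

lemma code_step: "x \<in> sdom (S m) \<Longrightarrow> code (Suc m) (j m x) = code m x"
  using emb[of m] by (simp add: embedding_def)

text \<open>Keeps old and new elements apart in \<open>code_inj\<close>: codes of new elements at
  stage \<open>Suc m\<close> have first coordinate exactly \<open>Suc m\<close>.\<close>

lemma code_level: "y \<in> sdom (S m) \<Longrightarrow> fst (prod_decode (code m y)) \<le> m"
proof (induction m arbitrary: y)
  case (Suc m)
  show ?case
  proof (cases "y \<in> j m ` sdom (S m)")
    case True
    then have "inv_into (sdom (S m)) (j m) y \<in> sdom (S m)" by (rule inv_into_into)
    with Suc.IH[OF this] True show ?thesis by simp
  qed simp
qed simp

lemma code_inj: "inj_on (code m) (sdom (S m))"
proof (induction m)
  case 0
  then show ?case by (simp add: inj_on_def)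
next
  case (Suc m)
  have lt: "code (Suc m) x \<noteq> code (Suc m) y"
    if "x \<in> j m ` sdom (S m)" "y \<notin> j m ` sdom (S m)" for x y
  proof -
    from that(1) obtain a where a: "a \<in> sdom (S m)" "x = j m a" by auto
    have "fst (prod_decode (code (Suc m) x)) \<le> m"
      unfolding a(2) code_step[OF a(1)] by (rule code_level[OF a(1)])
    moreover have "fst (prod_decode (code (Suc m) y)) = Suc m" using that(2) by simp
    ultimately show ?thesis by force
  qed
  show ?case
  proof (rule inj_onI)
    fix x y assume eq: "code (Suc m) x = code (Suc m) y"
    consider a b where "a \<in> sdom (S m)" "x = j m a" "b \<in> sdom (S m)" "y = j m b"
      | "x \<notin> j m ` sdom (S m)" "y \<notin> j m ` sdom (S m)"
      using lt[of x y] lt[of y x] eq by (metis imageE)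
    then show "x = y"
    proof cases
      case 1
      then have "code m a = code m b" using eq code_step by metis
      with Suc 1 show ?thesis by (metis inj_onD)
    next
      case 2
      with eq show ?thesis by simp
    qed
  qed
qed

lemma lift_stage:
  assumes "m \<le> k"
  shows "\<exists>e. embedding (S m) (S k) e \<and> (\<forall>x\<in>sdom (S m). code k (e x) = code m x)"
  using assms
proof (induction k rule: dec_induct)
  case base
  show ?case by (intro exI[of _ id] conjI embedding_id) simp
next
  case (step k)
  then obtain e where e: "embedding (S m) (S k) e" "\<forall>x\<in>sdom (S m). code k (e x) = code m x"
    by blast
  have "code (Suc k) ((j k \<circ> e) x) = code m x" if "x \<in> sdom (S m)" for x
  proof -
    have "e x \<in> sdom (S k)" using e(1) that by (auto simp: embedding_def)
    with code_step[of "e x" k] e(2) that show ?thesis by simp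
  qed
  with embedding_comp[OF e(1) emb] show ?case by blast
qed

lemma code_image_mono:
  assumes "m \<le> k"
  shows "code m ` sdom (S m) \<subseteq> code k ` sdom (S k)"
proof -
  from lift_stage[OF assms] obtain e where e: "embedding (S m) (S k) e"
    "\<forall>x\<in>sdom (S m). code k (e x) = code m x" by blast
  then have "e x \<in> sdom (S k)" if "x \<in> sdom (S m)" for x
    using that by (auto simp: embedding_def)
  with e(2) show ?thesis by (metis image_eqI image_subsetI)
qed

lemma finite_stage:
  assumes "finite F" "F \<subseteq> sdom L"
  shows "\<exists>m. F \<subseteq> code m ` sdom (S m)"
  using assms
proof (induction F rule: finite_induct)
  case (insert x F)
  then obtain m k where mk: "F \<subseteq> code m ` sdom (S m)" "x \<in> code k ` sdom (S k)"
    by (auto simp: sdom_chain_limit)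
  have "insert x F \<subseteq> code (max m k) ` sdom (S (max m k))"
    using mk code_image_mono[of m "max m k"] code_image_mono[of k "max m k"] by auto
  then show ?case by blast
qed auto

text \<open>A relation of the limit may be witnessed at another stage m'. Both tuples are pushed to
  the larger of the two stages, where injectivity of \<open>code\<close> makes them equal, and the
  relation is pulled back from there.\<close>

lemma code_embedding: "embedding (S m) L (code m)"
proof -
  have "srel (S m) l xs \<longleftrightarrow> srel L l (map (code m) xs)" if xs: "set xs \<subseteq> sdom (S m)" for l xs
  proof
    assume "srel (S m) l xs"
    with xs show "srel L l (map (code m) xs)" by (auto simp: srel_chain_limit)
  next
    assume "srel L l (map (code m) xs)"
    then obtain m' ys where ys: "set ys \<subseteq> sdom (S m')" "map (code m) xs = map (code m') ys"
      "srel (S m') l ys" by (auto simp: srel_chain_limit)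
    let ?k = "max m m'"
    obtain e where e: "embedding (S m) (S ?k) e" "\<forall>x\<in>sdom (S m). code ?k (e x) = code m x"
      using lift_stage[of m ?k] by auto
    obtain e' where e': "embedding (S m') (S ?k) e'" "\<forall>x\<in>sdom (S m'). code ?k (e' x) = code m' x"
      using lift_stage[of m' ?k] by auto
    have "map (code ?k) (map e xs) = map (code m) xs" using xs e(2) by auto
    moreover have "map (code ?k) (map e' ys) = map (code m') ys" using ys e'(2) by auto
    ultimately have "map (code ?k) (map e xs) = map (code ?k) (map e' ys)" using ys(2) by simp
    moreover have "e ` sdom (S m) \<subseteq> sdom (S ?k)" "e' ` sdom (S m') \<subseteq> sdom (S ?k)"
      using e(1) e'(1) by (auto simp: embedding_def)
    then have "set (map e xs) \<union> set (map e' ys) \<subseteq> sdom (S ?k)"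
      using xs ys(1) unfolding set_map by blast
    ultimately have eq: "map e xs = map e' ys"
      using code_inj[of ?k] by (meson inj_on_subset map_inj_on)
    have "srel (S ?k) l (map e' ys)"
      using e'(1) ys(1,3) unfolding embedding_def by blast
    with e(1) xs eq show "srel (S m) l xs" unfolding embedding_def by metis
  qed
  then show ?thesis
    using code_inj by (auto simp: embedding_def sdom_chain_limit)
qed

text \<open>Membership in the class is tested on finite subsets, and every finite subset of the
  limit lives in one stage.\<close>

lemma chain_limit_K_omega:
  assumes S: "\<And>m. S m \<in> K_omega ar K"
  shows "L \<in> K_omega ar K"
proof -
  have "length xs = ar l \<and> set xs \<subseteq> sdom L" if R: "srel L l xs" for l xs
  proof -
    from R obtain m ys where ys: "set ys \<subseteq> sdom (S m)" "xs = map (code m) ys" "srel (S m) l ys"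
      by (auto simp: srel_chain_limit)
    have "wf_struc ar (S m)" using S by (simp add: K_omega_def)
    then have "length xs = ar l" using ys by (simp add: wf_struc_def)
    moreover have "set xs \<subseteq> code m ` sdom (S m)" using ys by auto
    then have "set xs \<subseteq> sdom L" unfolding sdom_chain_limit by blast
    ultimately show ?thesis by blast
  qed
  moreover have "\<exists>B\<in>K. isomorphic (induced L F) B" if F: "finite F" "F \<subseteq> sdom L" for F
  proof -
    from finite_stage[OF F] obtain m where m: "F \<subseteq> code m ` sdom (S m)" by blast
    then obtain G where G: "G \<subseteq> sdom (S m)" "F = code m ` G" by (auto simp: subset_image_iff)
    have "finite G"
      using F(1) G code_inj[of m] by (metis finite_imageD inj_on_subset)
    with S[of m] G(1) obtain B b where B: "B \<in> K" "isomorphism (induced (S m) G) B b"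
      unfolding K_omega_def isomorphic_def by blast
    have "isomorphism (induced (S m) G) (induced L F) (code m)"
      using isomorphism_induced[OF code_embedding G(1)] G(2) by simp
    from isomorphism_comp[OF isomorphism_inv_into[OF this] B(2)] B(1)
    show ?thesis unfolding isomorphic_def by blast
  qed
  ultimately show ?thesis by (auto simp: K_omega_def wf_struc_def)
qed

end

section \<open>Isomorphisms of limits induced by commuting ladders of isomorphisms\<close>

definition chain_map :: "(nat \<Rightarrow> 'l struc) \<Rightarrow> (nat \<Rightarrow> nat \<Rightarrow> nat) \<Rightarrow> (nat \<Rightarrow> 'l struc) \<Rightarrow>
    (nat \<Rightarrow> nat \<Rightarrow> nat) \<Rightarrow> (nat \<Rightarrow> nat \<Rightarrow> nat) \<Rightarrow> nat \<Rightarrow> nat" where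
  "chain_map S j S' j' \<alpha> z = (case (SOME (m, x). x \<in> sdom (S m) \<and> chain_code S j m x = z) of
     (m, x) \<Rightarrow> chain_code S' j' m (\<alpha> m x))"

locale chain_morphism = chain S j + target: chain S' j'
  for S S' :: "nat \<Rightarrow> 'l struc" and j j' +
  fixes \<alpha> :: "nat \<Rightarrow> nat \<Rightarrow> nat"
  assumes iso: "isomorphism (S m) (S' m) (\<alpha> m)"
    and commute: "x \<in> sdom (S m) \<Longrightarrow> \<alpha> (Suc m) (j m x) = j' m (\<alpha> m x)"
begin

abbreviation "\<Phi> \<equiv> chain_map S j S' j' \<alpha>"

lemma \<alpha>_dom: "x \<in> sdom (S m) \<Longrightarrow> \<alpha> m x \<in> sdom (S' m)"
  using iso[of m] by (auto simp: isomorphism_def)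

text \<open>Independence of the representative. The later representative x' stays fixed while x is
  pushed forward one stage at a time; \<open>commute\<close> says that this does not change the
  image.\<close>

lemma code_\<alpha>_cong:
  assumes "x \<in> sdom (S m)" "x' \<in> sdom (S (m + d))" "code (m + d) x' = code m x"
  shows "target.code (m + d) (\<alpha> (m + d) x') = target.code m (\<alpha> m x)"
  using assms
proof (induction d arbitrary: m x)
  case 0
  then have "x' = x" using code_inj[of m] by (auto dest: inj_onD)
  then show ?case by simp
next
  case (Suc d)
  have "target.code (Suc m + d) (\<alpha> (Suc m + d) x') = target.code (Suc m) (\<alpha> (Suc m) (j m x))"
    using Suc.prems by (intro Suc.IH) (simp_all only: code_step j_dom add_Suc add_Suc_right)
  also have "\<dots> = target.code m (\<alpha> m x)"
    using Suc.prems(1) commute[of x m] target.code_step[OF \<alpha>_dom] by metis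
  finally show ?case by simp
qed

lemma chain_map_code:
  assumes "x \<in> sdom (S m)"
  shows "\<Phi> (code m x) = target.code m (\<alpha> m x)"
proof -
  obtain m' x' where mx: "(SOME (m', x'). x' \<in> sdom (S m') \<and> code m' x' = code m x) = (m', x')"
    by fastforce
  have *: "x' \<in> sdom (S m') \<and> code m' x' = code m x"
    using someI[of "\<lambda>(m', x'). x' \<in> sdom (S m') \<and> code m' x' = code m x" "(m, x)"] mx assms
    by simp
  have "target.code m' (\<alpha> m' x') = target.code m (\<alpha> m x)"
  proof (cases "m \<le> m'")
    case True
    with code_\<alpha>_cong[of x m x' "m' - m"] * assms show ?thesis by simp
  next
    case False
    with code_\<alpha>_cong[of x' m' x "m - m'"] * assms show ?thesis by simp
  qed
  then show ?thesis by (simp add: chain_map_def mx)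
qed

lemma chain_map_isomorphism: "isomorphism L target.L \<Phi>"
proof -
  have stage: "\<exists>m ys. set ys \<subseteq> sdom (S m) \<and> xs = map (code m) ys" if "set xs \<subseteq> sdom L" for xs
  proof -
    from finite_stage[OF _ that] obtain m where "set xs \<subseteq> code m ` sdom (S m)" by auto
    then have "xs \<in> lists (code m ` sdom (S m))" by auto
    then have "xs \<in> map (code m) ` lists (sdom (S m))" by (simp add: lists_image)
    then show ?thesis by auto
  qed
  have map_eq: "map \<Phi> (map (code m) ys) = map (target.code m) (map (\<alpha> m) ys)"
    if "set ys \<subseteq> sdom (S m)" for ys m
    using that chain_map_code by auto
  have "srel L l xs \<longleftrightarrow> srel target.L l (map \<Phi> xs)" if "set xs \<subseteq> sdom L" for l xs
  proof -
    from stage[OF that] obtain m ys where ys: "set ys \<subseteq> sdom (S m)" "xs = map (code m) ys" by blast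
    have "srel L l xs \<longleftrightarrow> srel (S m) l ys"
      using code_embedding[of m] ys unfolding embedding_def by blast
    also have "\<dots> \<longleftrightarrow> srel (S' m) l (map (\<alpha> m) ys)"
      using iso[of m] ys unfolding isomorphism_def embedding_def by blast
    also have "\<dots> \<longleftrightarrow> srel target.L l (map (target.code m) (map (\<alpha> m) ys))"
    proof -
      have "set (map (\<alpha> m) ys) \<subseteq> sdom (S' m)" using ys(1) \<alpha>_dom by auto
      then show ?thesis using target.code_embedding[of m] unfolding embedding_def by blast
    qed
    finally show ?thesis unfolding ys(2) map_eq[OF ys(1)] .
  qed
  moreover have "inj_on \<Phi> (sdom L)"
  proof (rule inj_onI)
    fix x y assume xy: "x \<in> sdom L" "y \<in> sdom L" and eq: "\<Phi> x = \<Phi> y"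
    from xy finite_stage[of "{x, y}"] obtain m a b where
      ab: "a \<in> sdom (S m)" "x = code m a" "b \<in> sdom (S m)" "y = code m b" by auto
    have "target.code m (\<alpha> m a) = target.code m (\<alpha> m b)"
      using eq unfolding ab(2,4) chain_map_code[OF ab(1)] chain_map_code[OF ab(3)] .
    then have "\<alpha> m a = \<alpha> m b"
      by (rule inj_onD[OF target.code_inj _ \<alpha>_dom[OF ab(1)] \<alpha>_dom[OF ab(3)]])
    moreover have "inj_on (\<alpha> m) (sdom (S m))"
      using iso[of m] by (simp add: isomorphism_def embedding_def)
    ultimately have "a = b" using ab(1,3) by (auto dest: inj_onD)
    with ab show "x = y" by simp
  qed
  moreover have "\<Phi> ` sdom L = sdom target.L"
  proof -
    have "\<Phi> ` code m ` sdom (S m) = target.code m ` sdom (S' m)" for m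
    proof -
      have "\<Phi> ` code m ` sdom (S m) = target.code m ` \<alpha> m ` sdom (S m)"
        by (simp add: image_image chain_map_code cong: image_cong_simp)
      with iso[of m] show ?thesis by (simp add: isomorphism_def)
    qed
    then show ?thesis by (simp add: sdom_chain_limit image_UN)
  qed
  ultimately show ?thesis unfolding isomorphism_def embedding_def by blast
qed

end

section \<open>Finitary types\<close>

text \<open>The parameters F belong to some other structure A; \<open>f\<close> places them in M,
  and y plays the role of the variable. The relations are read off in M.\<close>

definition type_of :: "'l struc \<Rightarrow> nat set \<Rightarrow> (nat \<Rightarrow> nat) \<Rightarrow> nat \<Rightarrow> 'l qftype" where
  "type_of M F f y = (F, \<lambda>l ys. set ys \<subseteq> insert None (Some ` F) \<and> srel M l (map (case_option y f) ys))"

lemma type_of_cong: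
  assumes "\<And>x. x \<in> F \<Longrightarrow> f x = g x"
  shows "type_of M F f y = type_of M F g y"
proof -
  have "map (case_option y f) ys = map (case_option y g) ys"
    if "set ys \<subseteq> insert None (Some ` F)" for ys
    using that assms by (auto split: option.split)
  then have "(set ys \<subseteq> insert None (Some ` F) \<and> srel M l (map (case_option y f) ys)) \<longleftrightarrow>
      (set ys \<subseteq> insert None (Some ` F) \<and> srel M l (map (case_option y g) ys))" for l ys
    by metis
  then show ?thesis by (simp only: type_of_def)
qed

lemma is_qftype_type_of:
  assumes "embedding (induced A F) M f" "finite F" "F \<subseteq> sdom A" "wf_struc ar M"
  shows "is_qftype ar A (type_of M F f y)"
proof -
  have "srel M l (map (case_option y f) (map Some xs)) \<longleftrightarrow> srel A l xs" if "set xs \<subseteq> F" for l xs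
  proof -
    have "srel (induced A F) l xs \<longleftrightarrow> srel M l (map f xs)"
      using assms(1) that unfolding embedding_def sdom_induced by blast
    moreover have eq: "map (case_option y f) (map Some xs) = map f xs" by simp
    ultimately show ?thesis using that unfolding eq by simp
  qed
  moreover have "length ys = ar l" if "srel M l (map (case_option y f) ys)" for l ys
    using assms(4) that by (metis length_map wf_struc_def)
  ultimately show ?thesis
    using assms(2,3) by (auto simp: is_qftype_def type_of_def simp del: map_map)
qed

text \<open>In an extension B realizing the type, the witness and the parameters form a finite
  substructure, which embeds into M; the type is preserved there.\<close>

lemma admissible_imp_type_of:
  assumes M: "fraisse_limit ar K M" and adm: "admissible ar (K_omega ar K) A \<tau>"
  obtains f y where "inj_on f (fst \<tau>)" "f ` fst \<tau> \<subseteq> sdom M" "y \<in> sdom M" "y \<notin> f ` fst \<tau>"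
    "\<tau> = type_of M (fst \<tau>) f y"
proof -
  let ?F = "fst \<tau>"
  from adm obtain B e b where B: "is_qftype ar A \<tau>" "B \<in> K_omega ar K" "embedding A B e"
    "realizes B e \<tau> b" unfolding admissible_def by blast
  have F: "finite ?F" "?F \<subseteq> sdom A" using B(1) by (auto simp: is_qftype_def)
  have dom: "insert b (e ` ?F) \<subseteq> sdom B"
    using B(3,4) F(2) by (auto simp: embedding_def realizes_def)
  obtain g where g: "embedding (induced B (insert b (e ` ?F))) M g"
    using fraisse_limit_age[OF M B(2) _ dom] F(1) by blast
  have inj_g: "inj_on g (insert b (e ` ?F))" using g by (simp add: embedding_def)
  have inj_e: "inj_on e ?F" using B(3) F(2) by (auto simp: embedding_def intro: inj_on_subset)
  have b: "b \<notin> e ` ?F" using B(4) by (simp add: realizes_def)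
  have 1: "inj_on (g \<circ> e) ?F"
    using inj_e inj_g by (auto intro!: comp_inj_on intro: inj_on_subset)
  have 2: "(g \<circ> e) ` ?F \<subseteq> sdom M" "g b \<in> sdom M"
    using g by (auto simp: embedding_def)
  have 3: "g b \<notin> (g \<circ> e) ` ?F"
    using inj_g b by (auto simp: inj_on_def)
  have "snd \<tau> l ys \<longleftrightarrow>
      set ys \<subseteq> insert None (Some ` ?F) \<and> srel M l (map (case_option (g b) (g \<circ> e)) ys)" for l ys
  proof (cases "set ys \<subseteq> insert None (Some ` ?F)")
    case True
    let ?xs = "map (case_option b e) ys"
    have "srel B l ?xs \<longleftrightarrow> snd \<tau> l ys"
      using B(4) True unfolding realizes_def by blast
    moreover have sub: "set ?xs \<subseteq> insert b (e ` ?F)"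
      using True by (force split: option.splits)
    then have "srel (induced B (insert b (e ` ?F))) l ?xs \<longleftrightarrow> srel M l (map g ?xs)"
      using g unfolding embedding_def sdom_induced by blast
    moreover have "map g ?xs = map (case_option (g b) (g \<circ> e)) ys"
      by (auto split: option.split)
    ultimately show ?thesis using True sub by (simp del: map_map)
  next
    case False
    then have "\<not> snd \<tau> l ys" using B(1) unfolding is_qftype_def by blast
    with False show ?thesis by blast
  qed
  then have "\<tau> = type_of M ?F (g \<circ> e) (g b)"
    by (auto simp: type_of_def prod_eq_iff fun_eq_iff)
  with 1 2 3 show ?thesis by (intro that)
qed

lemma admissible_type_of:
  assumes M: "M \<in> K_omega ar K" and C: "SAP (K_omega ar K)" and A: "A \<in> K_omega ar K"
    and q: "is_qftype ar A (type_of M F f y)"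
    and f: "inj_on f F" "f ` F \<subseteq> sdom M" "y \<in> sdom M" "y \<notin> f ` F"
  shows "admissible ar (K_omega ar K) A (type_of M F f y)"
proof -
  have F: "finite F" "F \<subseteq> sdom A" using q by (auto simp: is_qftype_def type_of_def)
  let ?G = "insert y (f ` F)"
  have G: "?G \<subseteq> sdom M" using f by auto
  have e1: "embedding (induced A F) A id" using embedding_of_induced[OF embedding_id F(2)] .
  \<comment> \<open>\<open>is_qftype\<close> forces the type to agree with A on the parameters,
    which is exactly what makes \<open>f\<close> an embedding of them into M.\<close>
  have "srel (induced A F) l xs \<longleftrightarrow> srel (induced M ?G) l (map f xs)" if xs: "set xs \<subseteq> F" for l xs
  proof -
    have "snd (type_of M F f y) l (map Some xs) \<longleftrightarrow> srel A l xs"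
      using q xs by (simp add: is_qftype_def type_of_def)
    moreover have "map (case_option y f) (map Some xs) = map f xs" by simp
    moreover have "set (map Some xs) \<subseteq> insert None (Some ` F)" "set (map f xs) \<subseteq> ?G"
      using xs by auto
    ultimately show ?thesis using xs by (simp add: type_of_def del: map_map set_map)
  qed
  then have e2: "embedding (induced A F) (induced M ?G) f"
    using f(1) by (auto simp: embedding_def)
  have C': "induced A F \<in> K_omega ar K" "induced M ?G \<in> K_omega ar K"
    using K_omega_induced A M F(2) G by blast+
  obtain D f1 f2 where D: "D \<in> K_omega ar K" "embedding A D f1"
    "embedding (induced M ?G) D f2" "\<forall>a\<in>F. f1 (id a) = f2 (f a)"
    using C[unfolded SAP_def, rule_format, OF C'(1) A C'(2) conjI[OF e1 e2]]
    unfolding sdom_induced by blast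
  have inj2: "inj_on f2 ?G" and f2: "f2 ` ?G \<subseteq> sdom D" using D(3) by (auto simp: embedding_def)
  have "f2 y \<notin> f1 ` F"
  proof
    assume "f2 y \<in> f1 ` F"
    then obtain a where a: "a \<in> F" "f2 y = f2 (f a)" using D(4) by auto
    then have "y = f a" using inj2 by (auto dest: inj_onD)
    with f(4) a(1) show False by auto
  qed
  moreover have "srel D l (map (case_option (f2 y) f1) ys) \<longleftrightarrow> srel M l (map (case_option y f) ys)"
    if ys: "set ys \<subseteq> insert None (Some ` F)" for l ys
  proof -
    have "map (case_option (f2 y) f1) ys = map f2 (map (case_option y f) ys)"
      using ys D(4) by (auto split: option.split)
    moreover have sub: "set (map (case_option y f) ys) \<subseteq> ?G"
      using ys by (force split: option.splits)
    moreover from sub have "srel (induced M ?G) l (map (case_option y f) ys) \<longleftrightarrow>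
        srel D l (map f2 (map (case_option y f) ys))"
      using D(3) unfolding embedding_def sdom_induced by blast
    ultimately show ?thesis by (simp del: map_map set_map)
  qed
  ultimately have "realizes D f1 (type_of M F f y) (f2 y)"
    using f2 by (simp add: realizes_def type_of_def)
  with q D(1,2) show ?thesis unfolding admissible_def by blast
qed

section \<open>Transport of types along isomorphisms\<close>

lemma transport_comp: "transport_type f (transport_type g \<tau>) = transport_type (f \<circ> g) \<tau>"
  by (auto simp: transport_type_def fun_eq_iff image_comp option.map_comp comp_def)

lemma transport_cong:
  assumes "is_qftype ar A \<tau>" "\<And>a. a \<in> fst \<tau> \<Longrightarrow> f a = g a"
  shows "transport_type f \<tau> = transport_type g \<tau>"
proof -
  have "map (map_option f) ys = map (map_option g) ys" if "snd \<tau> l ys" for l ys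
  proof -
    have "set ys \<subseteq> insert None (Some ` fst \<tau>)" using assms(1) that by (auto simp: is_qftype_def)
    with assms(2) show ?thesis by auto
  qed
  with assms(2) show ?thesis
    unfolding transport_type_def by (auto simp: fun_eq_iff)
qed

text \<open>The same extension B and the same witness b serve, with A' embedded through the inverse
  of \<open>\<alpha>\<close>.\<close>

lemma admissible_transport:
  assumes \<alpha>: "isomorphism A A' \<alpha>" and adm: "admissible ar C A \<tau>"
  shows "admissible ar C A' (transport_type \<alpha> \<tau>)"
proof -
  let ?F = "fst \<tau>" and ?\<tau> = "transport_type \<alpha> \<tau>"
  from adm obtain B e b where B: "is_qftype ar A \<tau>" "B \<in> C" "embedding A B e"
    "realizes B e \<tau> b" unfolding admissible_def by blast
  have F: "finite ?F" "?F \<subseteq> sdom A" using B(1) by (auto simp: is_qftype_def)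
  have inj: "inj_on \<alpha> (sdom A)" using \<alpha> by (simp add: isomorphism_def embedding_def)
  have fst: "fst ?\<tau> = \<alpha> ` ?F" by (simp add: transport_type_def)
  have injF: "inj_on \<alpha> ?F" using inj F(2) by (rule inj_on_subset)
  have injo: "inj_on (map_option \<alpha>) (insert None (Some ` ?F))"
    using injF by (auto simp: inj_on_def)
  have sub\<tau>: "set ys \<subseteq> insert None (Some ` ?F)" if "snd \<tau> l ys" for l ys
    using B(1) that by (auto simp: is_qftype_def)
  \<comment> \<open>\<open>transport_type\<close> is defined as an existential image; injectivity of
    \<open>\<alpha>\<close> on the parameters makes the preimage tuple unique.\<close>
  have rel: "snd ?\<tau> l (map (map_option \<alpha>) ys) \<longleftrightarrow> snd \<tau> l ys"
    if ys: "set ys \<subseteq> insert None (Some ` ?F)" for l ys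
  proof
    assume "snd ?\<tau> l (map (map_option \<alpha>) ys)"
    then obtain ys0 where ys0: "snd \<tau> l ys0" "map (map_option \<alpha>) ys = map (map_option \<alpha>) ys0"
      by (auto simp: transport_type_def)
    have "set ys \<union> set ys0 \<subseteq> insert None (Some ` ?F)" using ys sub\<tau>[OF ys0(1)] by blast
    then have "ys = ys0" using ys0(2) injo by (meson inj_on_subset map_inj_on)
    with ys0 show "snd \<tau> l ys" by simp
  qed (auto simp: transport_type_def)
  have im: "map_option \<alpha> ` insert None (Some ` ?F) = insert None (Some ` \<alpha> ` ?F)"
    by (auto simp: image_iff)
  have pre: "\<exists>ys0. set ys0 \<subseteq> insert None (Some ` ?F) \<and> ys = map (map_option \<alpha>) ys0"
    if "set ys \<subseteq> insert None (Some ` \<alpha> ` ?F)" for ys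
  proof -
    have "ys \<in> lists (map_option \<alpha> ` insert None (Some ` ?F))" using that im by auto
    then have "ys \<in> map (map_option \<alpha>) ` lists (insert None (Some ` ?F))" by (simp only: lists_image)
    then show ?thesis by auto
  qed
  have q: "is_qftype ar A' ?\<tau>"
    unfolding is_qftype_def fst
  proof (intro conjI allI impI)
    show "finite (\<alpha> ` ?F)" using F by simp
    show "\<alpha> ` ?F \<subseteq> sdom A'" using \<alpha> F(2) by (auto simp: isomorphism_def)
    fix l ys assume "snd ?\<tau> l ys"
    then obtain ys0 where ys0: "snd \<tau> l ys0" "ys = map (map_option \<alpha>) ys0"
      by (auto simp: transport_type_def)
    show "length ys = ar l" using B(1) ys0 by (auto simp: is_qftype_def)
    have "set ys \<subseteq> map_option \<alpha> ` insert None (Some ` ?F)" using sub\<tau>[OF ys0(1)] ys0(2) by auto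
    then show "set ys \<subseteq> insert None (Some ` \<alpha> ` ?F)" unfolding im .
  next
    fix l xs assume "set xs \<subseteq> \<alpha> ` ?F"
    then have "xs \<in> map \<alpha> ` lists ?F" unfolding lists_image[symmetric] by auto
    then obtain xs0 where xs0: "set xs0 \<subseteq> ?F" "xs = map \<alpha> xs0" by auto
    have "map Some xs = map (map_option \<alpha>) (map Some xs0)" using xs0(2) by simp
    moreover have "set (map Some xs0) \<subseteq> insert None (Some ` ?F)" using xs0(1) by auto
    ultimately have "snd ?\<tau> l (map Some xs) \<longleftrightarrow> snd \<tau> l (map Some xs0)" using rel by metis
    also have "\<dots> \<longleftrightarrow> srel A l xs0" using B(1) xs0(1) by (simp add: is_qftype_def)
    also have "\<dots> \<longleftrightarrow> srel A' l xs"
    proof -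
      have "set xs0 \<subseteq> sdom A" using xs0(1) F(2) by blast
      with \<alpha> xs0(2) show ?thesis unfolding isomorphism_def embedding_def by blast
    qed
    finally show "snd ?\<tau> l (map Some xs) \<longleftrightarrow> srel A' l xs" .
  qed
  define e' where "e' = e \<circ> inv_into (sdom A) \<alpha>"
  have e': "embedding A' B e'"
    unfolding e'_def using isomorphism_inv_into[OF \<alpha>]
    by (intro embedding_comp[OF _ B(3)]) (simp add: isomorphism_def)
  have e'\<alpha>: "e' (\<alpha> a) = e a" if "a \<in> ?F" for a
    using that F(2) inj by (auto simp: e'_def)
  have "realizes B e' ?\<tau> b"
    unfolding realizes_def fst
  proof (intro conjI allI impI)
    show "b \<in> sdom B" using B(4) by (simp add: realizes_def)
    have "e' ` \<alpha> ` ?F = e ` ?F" using e'\<alpha> by force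
    then show "b \<notin> e' ` \<alpha> ` ?F" using B(4) by (simp add: realizes_def)
    fix l ys assume "set ys \<subseteq> insert None (Some ` \<alpha> ` ?F)"
    then obtain ys0 where ys0: "set ys0 \<subseteq> insert None (Some ` ?F)" "ys = map (map_option \<alpha>) ys0"
      using pre by blast
    have "map (case_option b e') ys = map (case_option b e) ys0"
      using ys0 e'\<alpha> by (auto split: option.split)
    moreover have "srel B l (map (case_option b e) ys0) \<longleftrightarrow> snd \<tau> l ys0"
      using B(4) ys0(1) unfolding realizes_def by blast
    ultimately show "srel B l (map (case_option b e') ys) \<longleftrightarrow> snd ?\<tau> l ys"
      using rel[OF ys0(1)] ys0(2) by metis
  qed
  with q B(2) e' show ?thesis unfolding admissible_def by blast
qed

section \<open>Iterating the amalgamation functor\<close>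

locale borel_amalgamation =
  fixes ar :: "'l::countable \<Rightarrow> nat" and K :: "'l struc set" and M :: "'l struc" and n :: nat
    and E :: "'l struc \<Rightarrow> 'l struc" and \<iota> :: "'l struc \<Rightarrow> nat \<Rightarrow> nat"
    and w :: "'l struc \<Rightarrow> 'l qftype \<Rightarrow> nat \<Rightarrow> nat"
  assumes n: "n \<ge> 2"
    and limit: "fraisse_limit ar K M"
    and sap: "SAP (K_omega ar K)"
    and E_meas: "E \<in> measurable (restrict_space struc_space (K_omega ar K)) struc_space"
    and \<iota>_meas: "(\<lambda>A. \<iota> A a) \<in> measurable (restrict_space struc_space (K_omega ar K)) (count_space UNIV)"
    and w_meas: "(\<lambda>A. w A \<tau> i) \<in> measurable (restrict_space struc_space (K_omega ar K)) (count_space UNIV)"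
    and E_in: "A \<in> K_omega ar K \<Longrightarrow> E A \<in> K_omega ar K"
    and \<iota>_emb: "A \<in> K_omega ar K \<Longrightarrow> embedding A (E A) (\<iota> A)"
    and sdom_E: "A \<in> K_omega ar K \<Longrightarrow> sdom (E A) = \<iota> A ` sdom A \<union>
      {w A \<tau> i | \<tau> i. admissible ar (K_omega ar K) A \<tau> \<and> i \<in> {1..n}}"
    and disj: "A \<in> K_omega ar K \<Longrightarrow> \<iota> A ` sdom A \<inter>
      {w A \<tau> i | \<tau> i. admissible ar (K_omega ar K) A \<tau> \<and> i \<in> {1..n}} = {}"
    and w_inj: "A \<in> K_omega ar K \<Longrightarrow> inj_on (\<lambda>(\<tau>, i). w A \<tau> i)
      {(\<tau>, i). admissible ar (K_omega ar K) A \<tau> \<and> i \<in> {1..n}}"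
    and w_realizes: "A \<in> K_omega ar K \<Longrightarrow> admissible ar (K_omega ar K) A \<tau> \<Longrightarrow> i \<in> {1..n} \<Longrightarrow>
      realizes (E A) (\<iota> A) \<tau> (w A \<tau> i)"
    and cyclic: "A \<in> K_omega ar K \<Longrightarrow> \<exists>\<sigma>. isomorphism (E A) (E A) \<sigma> \<and>
      (\<forall>a\<in>sdom A. \<sigma> (\<iota> A a) = \<iota> A a) \<and>
      (\<forall>\<tau> i. admissible ar (K_omega ar K) A \<tau> \<and> i \<in> {1..n} \<longrightarrow> \<sigma> (w A \<tau> i) = w A \<tau> (cyc_next n i))"
    and natural: "A \<in> K_omega ar K \<Longrightarrow> A' \<in> K_omega ar K \<Longrightarrow> isomorphism A A' \<alpha> \<Longrightarrow>
      \<exists>\<beta>. isomorphism (E A) (E A') \<beta> \<and> (\<forall>a\<in>sdom A. \<beta> (\<iota> A a) = \<iota> A' (\<alpha> a)) \<and>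
        (\<forall>\<tau> i. admissible ar (K_omega ar K) A \<tau> \<and> i \<in> {1..n} \<longrightarrow>
           \<beta> (w A \<tau> i) = w A' (transport_type \<alpha> \<tau>) i)"
begin

abbreviation "C \<equiv> K_omega ar K"
abbreviation "adm \<equiv> admissible ar C"

lemma M_in: "M \<in> C"
  using limit by (simp add: fraisse_limit_def)

definition wits :: "'l struc \<Rightarrow> ('l qftype \<times> nat) set" where
  "wits A = {(\<tau>, i). adm A \<tau> \<and> i \<in> {1..n}}"

text \<open>With \<open>s = id\<close> this is the natural extension of \<open>\<alpha>\<close>;
  with \<open>s = cyc_next n\<close> it is the natural extension followed by the rotation of
  witnesses. An explicit formula is needed to iterate the extension and to compute its graph
  measurably.\<close>

definition ext :: "(nat \<Rightarrow> nat) \<Rightarrow> 'l struc \<Rightarrow> 'l struc \<Rightarrow> (nat \<Rightarrow> nat) \<Rightarrow> nat \<Rightarrow> nat" where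
  "ext s A A' \<alpha> y = (if y \<in> \<iota> A ` sdom A then \<iota> A' (\<alpha> (inv_into (sdom A) (\<iota> A) y))
     else case inv_into (wits A) (\<lambda>(\<tau>, i). w A \<tau> i) y of (\<tau>, i) \<Rightarrow> w A' (transport_type \<alpha> \<tau>) (s i))"

lemma ext_\<iota>:
  assumes "A \<in> C" "a \<in> sdom A"
  shows "ext s A A' \<alpha> (\<iota> A a) = \<iota> A' (\<alpha> a)"
  using \<iota>_emb[OF assms(1)] assms(2) by (simp add: ext_def embedding_def)

lemma w_notin:
  assumes "A \<in> C" "adm A \<tau>" "i \<in> {1..n}"
  shows "w A \<tau> i \<notin> \<iota> A ` sdom A"
  using disj[OF assms(1)] assms(2,3) by blast

lemma w_in:
  assumes "A \<in> C" "adm A \<tau>" "i \<in> {1..n}"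
  shows "w A \<tau> i \<in> sdom (E A)"
  unfolding sdom_E[OF assms(1)] using assms(2,3) by blast

lemma ext_w:
  assumes "A \<in> C" "adm A \<tau>" "i \<in> {1..n}"
  shows "ext s A A' \<alpha> (w A \<tau> i) = w A' (transport_type \<alpha> \<tau>) (s i)"
proof -
  have "(\<tau>, i) \<in> wits A" using assms(2,3) by (simp add: wits_def)
  moreover have "inj_on (\<lambda>(\<tau>, i). w A \<tau> i) (wits A)"
    unfolding wits_def by (rule w_inj[OF assms(1)])
  ultimately have "inv_into (wits A) (\<lambda>(\<tau>, i). w A \<tau> i) (w A \<tau> i) = (\<tau>, i)"
    using inv_into_f_f[of "\<lambda>(\<tau>, i). w A \<tau> i" "wits A" "(\<tau>, i)"] by simp
  with w_notin[OF assms] show ?thesis by (simp add: ext_def)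
qed

lemma E_cases:
  assumes "A \<in> C" "y \<in> sdom (E A)"
  obtains (old) a where "a \<in> sdom A" "y = \<iota> A a"
    | (new) \<tau> i where "adm A \<tau>" "i \<in> {1..n}" "y = w A \<tau> i"
  using assms(2) unfolding sdom_E[OF assms(1)] by blast

lemma ext_id_isomorphism:
  assumes "A \<in> C" "A' \<in> C" "isomorphism A A' \<alpha>"
  shows "isomorphism (E A) (E A') (ext id A A' \<alpha>)"
proof -
  from natural[OF assms] obtain \<beta> where \<beta>: "isomorphism (E A) (E A') \<beta>"
    "\<forall>a\<in>sdom A. \<beta> (\<iota> A a) = \<iota> A' (\<alpha> a)"
    "\<forall>\<tau> i. adm A \<tau> \<and> i \<in> {1..n} \<longrightarrow> \<beta> (w A \<tau> i) = w A' (transport_type \<alpha> \<tau>) i" by blast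
  have "\<beta> y = ext id A A' \<alpha> y" if "y \<in> sdom (E A)" for y
    using assms(1) that
  proof (cases rule: E_cases)
    case (old a)
    then show ?thesis using \<beta>(2) ext_\<iota>[OF assms(1)] by simp
  next
    case (new \<tau> i)
    then show ?thesis using \<beta>(3)[rule_format, OF conjI[OF new(1,2)]] ext_w[OF assms(1) new(1,2)] by simp
  qed
  with \<beta>(1) show ?thesis by (rule isomorphism_cong)
qed

text \<open>On \<open>E A\<close> this map is the natural extension of \<open>\<phi>\<close>
  followed by the given cyclic automorphism, which applies because the transported type is again
  admissible.\<close>

lemma ext_cyc_isomorphism:
  assumes "A \<in> C" "isomorphism A A \<phi>"
  shows "isomorphism (E A) (E A) (ext (cyc_next n) A A \<phi>)"
proof -
  from cyclic[OF assms(1)] obtain \<sigma> where \<sigma>: "isomorphism (E A) (E A) \<sigma>"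
    "\<forall>a\<in>sdom A. \<sigma> (\<iota> A a) = \<iota> A a"
    "\<forall>\<tau> i. adm A \<tau> \<and> i \<in> {1..n} \<longrightarrow> \<sigma> (w A \<tau> i) = w A \<tau> (cyc_next n i)" by blast
  have "(\<sigma> \<circ> ext id A A \<phi>) y = ext (cyc_next n) A A \<phi> y" if "y \<in> sdom (E A)" for y
    using assms(1) that
  proof (cases rule: E_cases)
    case (old a)
    have "\<phi> a \<in> sdom A" using assms(2) old(1) by (auto simp: isomorphism_def)
    with old show ?thesis using \<sigma>(2) ext_\<iota>[OF assms(1)] by simp
  next
    case (new \<tau> i)
    have "adm A (transport_type \<phi> \<tau>)" using assms(2) new(1) by (rule admissible_transport)
    from \<sigma>(3)[rule_format, OF conjI[OF this new(2)]] new(3) show ?thesis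
      using ext_w[OF assms(1) new(1,2)] by simp
  qed
  with isomorphism_comp[OF ext_id_isomorphism[OF assms(1,1,2)] \<sigma>(1)]
  show ?thesis by (rule isomorphism_cong)
qed

lemma cyc_next_in: "i \<in> {1..n} \<Longrightarrow> cyc_next n i \<in> {1..n}"
  by (auto simp: cyc_next_def)

text \<open>For \<open>n = 1\<close> the rotation would be the identity; \<open>n \<ge> 2\<close>
  makes it free of fixed points.\<close>

lemma cyc_next_neq: "i \<in> {1..n} \<Longrightarrow> cyc_next n i \<noteq> i"
  using n by (auto simp: cyc_next_def)

lemma adm_qftype: "adm A \<tau> \<Longrightarrow> is_qftype ar A \<tau>"
  by (simp add: admissible_def)

lemma adm_fst: "adm A \<tau> \<Longrightarrow> fst \<tau> \<subseteq> sdom A"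
  by (simp add: admissible_def is_qftype_def)

text \<open>On witnesses, \<open>\<alpha>\<close> changes only the type while the rotation changes
  only the index, so only the two transports of the type have to be compared; they agree by
  \<open>comm\<close>.\<close>

lemma ext_commute:
  assumes A: "A \<in> C" "A' \<in> C" and \<alpha>: "isomorphism A A' \<alpha>"
    and \<phi>: "isomorphism A A \<phi>" "isomorphism A' A' \<phi>'"
    and comm: "\<And>a. a \<in> sdom A \<Longrightarrow> \<alpha> (\<phi> a) = \<phi>' (\<alpha> a)" and y: "y \<in> sdom (E A)"
  shows "ext id A A' \<alpha> (ext (cyc_next n) A A \<phi> y) = ext (cyc_next n) A' A' \<phi>' (ext id A A' \<alpha> y)"
  using A(1) y
proof (cases rule: E_cases)
  case (old a)
  have "\<phi> a \<in> sdom A" "\<alpha> a \<in> sdom A'"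
    using \<alpha> \<phi> old(1) by (auto simp: isomorphism_def)
  with old comm show ?thesis by (simp add: ext_\<iota> A)
next
  case (new \<tau> i)
  have "transport_type \<alpha> (transport_type \<phi> \<tau>) = transport_type \<phi>' (transport_type \<alpha> \<tau>)"
    unfolding transport_comp
    using comm adm_fst[OF new(1)] by (intro transport_cong[OF adm_qftype[OF new(1)]]) auto
  with new admissible_transport[OF \<alpha> new(1)] admissible_transport[OF \<phi>(1) new(1)] cyc_next_in[OF new(2)]
  show ?thesis by (simp add: ext_w A)
qed

text \<open>Even when \<open>\<phi>\<close> preserves a type, the index moves, and
  \<open>w_inj\<close> turns different pairs of type and index into different witnesses. So no
  witness is fixed.\<close>

lemma ext_fixed_iff:
  assumes A: "A \<in> C" and \<phi>: "isomorphism A A \<phi>" and y: "y \<in> sdom (E A)"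
  shows "ext (cyc_next n) A A \<phi> y = y \<longleftrightarrow> (\<exists>a\<in>sdom A. \<phi> a = a \<and> y = \<iota> A a)"
  using A y
proof (cases rule: E_cases)
  case (old a)
  have inj: "inj_on (\<iota> A) (sdom A)" using \<iota>_emb[OF A] by (simp add: embedding_def)
  have "\<phi> a \<in> sdom A" using \<phi> old(1) by (auto simp: isomorphism_def)
  with old inj show ?thesis by (auto simp: ext_\<iota>[OF A] inj_on_eq_iff)
next
  case (new \<tau> i)
  have "w A (transport_type \<phi> \<tau>) (cyc_next n i) \<noteq> w A \<tau> i"
  proof
    assume "w A (transport_type \<phi> \<tau>) (cyc_next n i) = w A \<tau> i"
    then have "(transport_type \<phi> \<tau>, cyc_next n i) = (\<tau>, i)"
      using new admissible_transport[OF \<phi> new(1)] cyc_next_in[OF new(2)]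
      by (intro inj_onD[OF w_inj[OF A]]) auto
    then show False using cyc_next_neq[OF new(2)] by simp
  qed
  then have "ext (cyc_next n) A A \<phi> y \<noteq> y" using new by (simp add: ext_w[OF A])
  moreover have "y \<notin> \<iota> A ` sdom A" using w_notin[OF A new(1,2)] new(3) by simp
  ultimately show ?thesis by blast
qed

section \<open>The tower of iterates, its limit and the automorphism that encodes A\<close>

definition stage :: "'l struc \<Rightarrow> nat \<Rightarrow> 'l struc" where
  "stage A m = (E ^^ m) A"

definition incl :: "'l struc \<Rightarrow> nat \<Rightarrow> nat \<Rightarrow> nat" where
  "incl A m = \<iota> (stage A m)"

primrec aut :: "'l struc \<Rightarrow> nat \<Rightarrow> nat \<Rightarrow> nat" where
  "aut A 0 = id"
| "aut A (Suc m) = ext (cyc_next n) (stage A m) (stage A m) (aut A m)"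

primrec lift :: "'l struc \<Rightarrow> 'l struc \<Rightarrow> (nat \<Rightarrow> nat) \<Rightarrow> nat \<Rightarrow> nat \<Rightarrow> nat" where
  "lift A A' \<alpha> 0 = \<alpha>"
| "lift A A' \<alpha> (Suc m) = ext id (stage A m) (stage A' m) (lift A A' \<alpha> m)"

abbreviation "code A \<equiv> chain_code (stage A) (incl A)"
abbreviation "W A \<equiv> chain_limit (stage A) (incl A)"
abbreviation "\<Phi> A \<equiv> chain_map (stage A) (incl A) (stage A) (incl A) (aut A)"

lemma stage_0 [simp]: "stage A 0 = A"
  by (simp add: stage_def)

lemma stage_Suc [simp]: "stage A (Suc m) = E (stage A m)"
  by (simp add: stage_def)

lemma stage_in: "A \<in> C \<Longrightarrow> stage A m \<in> C"
  by (induction m) (auto intro: E_in)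

lemma chain_stage: "A \<in> C \<Longrightarrow> chain (stage A) (incl A)"
  by (auto simp: chain_def incl_def intro!: \<iota>_emb stage_in)

lemma aut_isomorphism: "A \<in> C \<Longrightarrow> isomorphism (stage A m) (stage A m) (aut A m)"
  by (induction m) (auto simp: isomorphism_id intro!: ext_cyc_isomorphism stage_in)

lemma chain_morphism_aut: "A \<in> C \<Longrightarrow> chain_morphism (stage A) (stage A) (incl A) (incl A) (aut A)"
  by (intro chain_morphism.intro chain_stage chain_morphism_axioms.intro aut_isomorphism)
    (auto simp: incl_def ext_\<iota> stage_in)

lemma lift_isomorphism:
  assumes "A \<in> C" "A' \<in> C" "isomorphism A A' \<alpha>"
  shows "isomorphism (stage A m) (stage A' m) (lift A A' \<alpha> m)"
  using assms by (induction m) (auto intro!: ext_id_isomorphism stage_in)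

lemma chain_morphism_lift:
  assumes "A \<in> C" "A' \<in> C" "isomorphism A A' \<alpha>"
  shows "chain_morphism (stage A) (stage A') (incl A) (incl A') (lift A A' \<alpha>)"
  using assms by (intro chain_morphism.intro chain_stage chain_morphism_axioms.intro lift_isomorphism)
    (auto simp: incl_def ext_\<iota> stage_in)

lemma lift_commute:
  assumes A: "A \<in> C" "A' \<in> C" "isomorphism A A' \<alpha>" and "x \<in> sdom (stage A m)"
  shows "lift A A' \<alpha> m (aut A m x) = aut A' m (lift A A' \<alpha> m x)"
  using assms(4)
proof (induction m arbitrary: x)
  case (Suc m)
  then show ?case
    using ext_commute[OF stage_in[OF A(1)] stage_in[OF A(2)] lift_isomorphism[OF A]
        aut_isomorphism[OF A(1)] aut_isomorphism[OF A(2)]] by simp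
qed simp

lemma W_in: "A \<in> C \<Longrightarrow> W A \<in> C"
  using chain.chain_limit_K_omega[OF chain_stage] stage_in by blast

lemma \<Phi>_isomorphism: "A \<in> C \<Longrightarrow> isomorphism (W A) (W A) (\<Phi> A)"
  using chain_morphism.chain_map_isomorphism[OF chain_morphism_aut] by blast

lemma \<Phi>_code:
  "A \<in> C \<Longrightarrow> x \<in> sdom (stage A m) \<Longrightarrow> \<Phi> A (code A m x) = code A m (aut A m x)"
  using chain_morphism.chain_map_code[OF chain_morphism_aut] by blast

lemma isomorphic_imp_conjugating:
  assumes A: "A \<in> C" "A' \<in> C" "isomorphism A A' \<alpha>"
  obtains \<gamma> where "isomorphism (W A) (W A') \<gamma>" "\<And>z. z \<in> sdom (W A) \<Longrightarrow> \<gamma> (\<Phi> A z) = \<Phi> A' (\<gamma> z)"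
proof -
  interpret f: chain_morphism "stage A" "stage A'" "incl A" "incl A'" "lift A A' \<alpha>"
    by (rule chain_morphism_lift[OF A])
  have "f.\<Phi> (\<Phi> A z) = \<Phi> A' (f.\<Phi> z)" if "z \<in> sdom (W A)" for z
  proof -
    from that obtain m x where x: "x \<in> sdom (stage A m)" "z = code A m x"
      by (auto simp: sdom_chain_limit)
    have "aut A m x \<in> sdom (stage A m)"
      using aut_isomorphism[OF A(1), of m] x(1) by (auto simp: isomorphism_def)
    then show ?thesis
      unfolding x(2) using x(1) f.\<alpha>_dom[OF x(1)]
      by (simp only: \<Phi>_code A f.chain_map_code lift_commute[OF A])
  qed
  with f.chain_map_isomorphism that show ?thesis by blast
qed

text \<open>The automorphism is the identity at stage 0, and by \<open>ext_fixed_iff\<close> each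
  later stage keeps exactly the images of the earlier fixed points. Hence every fixed point traces
  back to A.\<close>

lemma aut_fixed_iff:
  assumes A: "A \<in> C" and "x \<in> sdom (stage A m)"
  shows "aut A m x = x \<longleftrightarrow> code A m x \<in> code A 0 ` sdom A"
  using assms(2)
proof (induction m arbitrary: x)
  case 0
  then show ?case by simp
next
  case (Suc m)
  interpret c: chain "stage A" "incl A" by (rule chain_stage[OF A])
  have "aut A (Suc m) x = x \<longleftrightarrow> (\<exists>a\<in>sdom (stage A m). aut A m a = a \<and> x = incl A m a)"
    using ext_fixed_iff[OF stage_in[OF A] aut_isomorphism[OF A], of x m] Suc.prems
    by (simp add: incl_def)
  also have "\<dots> \<longleftrightarrow> (\<exists>a\<in>sdom (stage A m). code A m a \<in> code A 0 ` sdom A \<and> x = incl A m a)"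
    using Suc.IH by blast
  also have "\<dots> \<longleftrightarrow> code A (Suc m) x \<in> code A 0 ` sdom A"
  proof
    assume "\<exists>a\<in>sdom (stage A m). code A m a \<in> code A 0 ` sdom A \<and> x = incl A m a"
    then show "code A (Suc m) x \<in> code A 0 ` sdom A" using c.code_step by metis
  next
    assume fix0: "code A (Suc m) x \<in> code A 0 ` sdom A"
    then have "code A (Suc m) x \<in> code A m ` sdom (stage A m)"
      using c.code_image_mono[of 0 m] unfolding stage_0 by blast
    then obtain a where a: "a \<in> sdom (stage A m)" "code A (Suc m) x = code A m a" by blast
    have "code A (Suc m) x = code A (Suc m) (incl A m a)"
      unfolding a(2) c.code_step[OF a(1)] ..
    then have "x = incl A m a"
      by (rule inj_onD[OF c.code_inj _ Suc.prems c.j_dom[OF a(1)]])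
    with a fix0 show "\<exists>a\<in>sdom (stage A m). code A m a \<in> code A 0 ` sdom A \<and> x = incl A m a"
      by metis
  qed
  finally show ?case .
qed

lemma \<Phi>_fixed_points:
  assumes A: "A \<in> C"
  shows "{z \<in> sdom (W A). \<Phi> A z = z} = code A 0 ` sdom A"
proof -
  interpret c: chain "stage A" "incl A" by (rule chain_stage[OF A])
  have "\<Phi> A z = z \<longleftrightarrow> z \<in> code A 0 ` sdom A" if "z \<in> sdom (W A)" for z
  proof -
    from that obtain m x where x: "x \<in> sdom (stage A m)" and z: "z = code A m x"
      unfolding sdom_chain_limit by blast
    have "aut A m x \<in> sdom (stage A m)"
      using aut_isomorphism[OF A, of m] x by (auto simp: isomorphism_def)
    then have "code A m (aut A m x) = code A m x \<longleftrightarrow> aut A m x = x"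
      using c.code_inj[of m] x by (simp add: inj_on_eq_iff)
    with aut_fixed_iff[OF A x] show ?thesis unfolding z \<Phi>_code[OF A x] by blast
  qed
  moreover have "code A 0 ` sdom (stage A 0) \<subseteq> sdom (W A)"
    unfolding sdom_chain_limit by (rule UN_upper) simp
  ultimately show ?thesis unfolding stage_0 by blast
qed

text \<open>An intertwining isomorphism carries fixed points onto fixed points, and the
  substructures on them are copies of A and A' through \<open>code\<close> at stage 0.\<close>

lemma conjugating_imp_isomorphic:
  assumes A: "A \<in> C" "A' \<in> C" and \<gamma>: "isomorphism (W A) (W A') \<gamma>"
    and comm: "\<And>z. z \<in> sdom (W A) \<Longrightarrow> \<gamma> (\<Phi> A z) = \<Phi> A' (\<gamma> z)"
  shows "isomorphic A A'"
proof -
  let ?F = "\<lambda>A. code A 0 ` sdom A"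
  have emb: "isomorphism A (induced (W A) (?F A)) (code A 0)" if "A \<in> C" for A
    using isomorphism_onto_image[OF chain.code_embedding[OF chain_stage[OF that], of 0]] by simp
  have \<gamma>bij: "inj_on \<gamma> (sdom (W A))" "\<gamma> ` sdom (W A) = sdom (W A')"
    using \<gamma> by (auto simp: isomorphism_def embedding_def)
  have \<Phi>_in: "\<Phi> A z \<in> sdom (W A)" if "z \<in> sdom (W A)" for z
    using \<Phi>_isomorphism[OF A(1)] that by (auto simp: isomorphism_def)
  have "\<Phi> A' (\<gamma> z) = \<gamma> z \<longleftrightarrow> \<Phi> A z = z" if "z \<in> sdom (W A)" for z
    using comm[OF that] \<gamma>bij(1) that \<Phi>_in[OF that] by (metis inj_onD)
  then have "\<gamma> ` {z \<in> sdom (W A). \<Phi> A z = z} = {z \<in> sdom (W A'). \<Phi> A' z = z}"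
    using \<gamma>bij(2) by force
  then have F: "\<gamma> ` ?F A = ?F A'" using \<Phi>_fixed_points A by simp
  have "?F A \<subseteq> sdom (W A)" using \<Phi>_fixed_points[OF A(1)] by blast
  then have "isomorphism (induced (W A) (?F A)) (induced (W A') (?F A')) \<gamma>"
    using isomorphism_induced[of "W A" "W A'" \<gamma> "?F A"] \<gamma> F by (simp add: isomorphism_def)
  from isomorphism_comp[OF isomorphism_comp[OF emb[OF A(1)] this] isomorphism_inv_into[OF emb[OF A(2)]]]
  show ?thesis unfolding isomorphic_def by blast
qed

text \<open>The finitely many parameters of p lie in a single stage m. The type of y in M, pulled
  back to that stage along p, is admissible there, and its witness at stage \<open>Suc m\<close> is
  the required partner of y.\<close>

lemma ext_prop_W:
  assumes A: "A \<in> C"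
  shows "ext_prop M (W A)"
  unfolding ext_prop_def
proof (intro allI impI)
  fix p y assume p: "finite p \<and> partial_iso (W A) M p \<and> y \<in> sdom M"
  interpret c: chain "stage A" "incl A" by (rule chain_stage[OF A])
  show "\<exists>x. partial_iso (W A) M (insert (x, y) p)"
  \<comment> \<open>Types describe elements outside their parameter set, so a y that already has a
    partner is treated separately.\<close>
  proof (cases "y \<in> snd ` p")
    case True
    then obtain x where "(x, y) \<in> p" by auto
    then have "insert (x, y) p = p" by auto
    with p show ?thesis by metis
  next
    case False
    define F where "F = fst ` p"
    from p obtain f where f: "embedding (induced (W A) F) M f" "p = (\<lambda>x. (x, f x)) ` F"
      unfolding F_def using partial_iso_mapE by metis
    have F: "finite F" "F \<subseteq> sdom (W A)" using p by (auto simp: F_def partial_iso_def)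
    then obtain m where "F \<subseteq> code A m ` sdom (stage A m)" using c.finite_stage by blast
    then obtain G where G: "G \<subseteq> sdom (stage A m)" "F = code A m ` G" by (auto simp: subset_image_iff)
    have "finite G" using F(1) G c.code_inj[of m] by (metis finite_imageD inj_on_subset)
    have fG: "embedding (induced (stage A m) G) M (f \<circ> code A m)"
    proof -
      have "embedding (induced (stage A m) G) (induced (W A) F) (code A m)"
        using isomorphism_induced[OF c.code_embedding G(1)] G(2) by (simp add: isomorphism_def)
      from embedding_comp[OF this f(1)] show ?thesis .
    qed
    let ?f = "f \<circ> code A m" and ?S = "stage A m"
    define \<tau> where "\<tau> = type_of M G ?f y"
    have "wf_struc ar M" using M_in by (simp add: K_omega_def)
    then have q: "is_qftype ar ?S \<tau>"
      unfolding \<tau>_def using is_qftype_type_of[OF fG \<open>finite G\<close> G(1)] by blast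
    have "y \<notin> ?f ` G" using False f(2) G(2) by force
    then have "adm ?S \<tau>"
      unfolding \<tau>_def using fG p q[unfolded \<tau>_def]
      by (intro admissible_type_of M_in sap stage_in A) (auto simp: embedding_def)
    \<comment> \<open>Any index in \<open>{1..n}\<close> would serve; 1 is available because
      \<open>n \<ge> 2\<close>.\<close>
    define b where "b = w ?S \<tau> 1"
    have b: "b \<in> sdom (E ?S)" "realizes (E ?S) (\<iota> ?S) \<tau> b" "b \<notin> \<iota> ?S ` sdom ?S"
      using w_in[OF stage_in[OF A] \<open>adm ?S \<tau>\<close>, of 1] w_realizes[OF stage_in[OF A] \<open>adm ?S \<tau>\<close>, of 1]
        w_notin[OF stage_in[OF A] \<open>adm ?S \<tau>\<close>, of 1] n by (auto simp: b_def)
    define x where "x = code A (Suc m) b"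
    have \<iota>_in: "\<iota> ?S g \<in> sdom (E ?S)" if "g \<in> G" for g
      using \<iota>_emb[OF stage_in[OF A, of m]] that G(1) unfolding embedding_def by blast
    have code_\<iota>: "code A (Suc m) (\<iota> ?S g) = code A m g" if "g \<in> G" for g
      using c.code_step[of g m] that G(1) unfolding incl_def by blast
    have "x \<notin> F"
    proof
      assume "x \<in> F"
      then obtain g where g: "g \<in> G" "x = code A m g" using G(2) by auto
      then have "code A (Suc m) b = code A (Suc m) (\<iota> ?S g)" by (simp only: x_def code_\<iota>)
      then have "b = \<iota> ?S g"
        using b(1) \<iota>_in[OF g(1)] inj_onD[OF c.code_inj[of "Suc m"]] unfolding stage_Suc by blast
      with b(3) g(1) G(1) show False by blast
    qed
    \<comment> \<open>A type variable is sent to its pair of interpretations in the limit and in M.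
      Every tuple from the extended p thus comes from one tuple of variables, on which both sides
      are decided by the type.\<close>
    define T where "T = case_option (x, y) (\<lambda>g. (code A m g, ?f g))"
    have "p = (\<lambda>g. (code A m g, ?f g)) ` G" using f(2) G(2) by (simp add: image_image)
    then have T: "insert (x, y) p = T ` insert None (Some ` G)"
      by (simp add: T_def image_image)
    have "srel (W A) l (map fst zs) \<longleftrightarrow> srel M l (map snd zs)" if zs: "set zs \<subseteq> insert (x, y) p" for l zs
    proof -
      have "zs \<in> lists (T ` insert None (Some ` G))" using zs T by auto
      then have "zs \<in> map T ` lists (insert None (Some ` G))" by (simp only: lists_image)
      then obtain ys where ys: "set ys \<subseteq> insert None (Some ` G)" "zs = map T ys" by auto
      let ?xs = "map (case_option b (\<iota> ?S)) ys"
      have "map fst zs = map (code A (Suc m)) ?xs"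
        unfolding ys(2) map_map
      proof (rule map_cong[OF refl])
        fix o' assume "o' \<in> set ys"
        with ys(1) have "o' = None \<or> (\<exists>g\<in>G. o' = Some g)" by auto
        then show "(fst \<circ> T) o' = (code A (Suc m) \<circ> case_option b (\<iota> ?S)) o'"
          unfolding comp_def T_def x_def using code_\<iota> by (elim disjE bexE) (simp_all only: option.case fst_conv)
      qed
      moreover have "set ?xs \<subseteq> sdom (stage A (Suc m))"
        using ys(1) b(1) \<iota>_in by (auto split: option.split)
      then have "srel (stage A (Suc m)) l ?xs \<longleftrightarrow> srel (W A) l (map (code A (Suc m)) ?xs)"
        using c.code_embedding[of "Suc m"] unfolding embedding_def by blast
      moreover have "srel (E ?S) l ?xs \<longleftrightarrow> snd \<tau> l ys"
        using b(2) ys(1) unfolding realizes_def \<tau>_def type_of_def fst_conv by blast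
      moreover have "snd \<tau> l ys \<longleftrightarrow> srel M l (map (case_option y ?f) ys)"
        using ys(1) by (simp add: \<tau>_def type_of_def)
      moreover have "map snd zs = map (case_option y ?f) ys"
        unfolding ys(2) map_map by (rule map_cong) (auto simp: T_def split: option.split)
      ultimately show ?thesis unfolding stage_Suc by metis
    qed
    moreover have "x \<in> sdom (W A)"
      using c.code_embedding[of "Suc m"] b(1) unfolding x_def embedding_def stage_Suc by blast
    then have "fst ` insert (x, y) p \<subseteq> sdom (W A)" "snd ` insert (x, y) p \<subseteq> sdom M"
      using p by (auto simp: partial_iso_def)
    moreover have "fst a \<noteq> x \<and> snd a \<noteq> y" if "a \<in> p" for a
      using that False \<open>x \<notin> F\<close> by (auto simp: F_def)
    then have "\<forall>a\<in>insert (x, y) p. \<forall>b\<in>insert (x, y) p. fst a = fst b \<longleftrightarrow> snd a = snd b"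
      using p unfolding partial_iso_def by (metis fst_conv insertE snd_conv)
    ultimately have "partial_iso (W A) M (insert (x, y) p)"
      unfolding partial_iso_def by blast
    then show ?thesis by blast
  qed
qed

end

context borel_amalgamation
begin

section \<open>Measurability of the limit\<close>

abbreviation "N \<equiv> restrict_space struc_space C"

lemma space_N [simp]: "space N = C"
  by (simp add: space_restrict_space)

lemma measurable_N_struc: "f \<in> measurable X N \<Longrightarrow> f \<in> measurable X struc_space"
  by (simp add: measurable_restrict_space2_iff)

lemma stage_meas: "(\<lambda>A. stage A m) \<in> measurable N N"
proof (induction m)
  case (Suc m)
  have "E \<in> measurable N N"
    using E_meas E_in by (intro measurable_restrict_space2) auto
  from measurable_compose[OF Suc.IH this] show ?case by simp
qed simp

lemmas pred_sdom_stage = pred_sdom[OF measurable_N_struc[OF stage_meas]]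
lemmas pred_srel_stage = pred_srel[OF measurable_N_struc[OF stage_meas]]

lemma pred_\<iota>: "Measurable.pred N (\<lambda>A. \<iota> (stage A m) a = b)"
  by (rule measurable_compose[OF measurable_compose[OF stage_meas \<iota>_meas]]) simp

lemma pred_w: "Measurable.pred N (\<lambda>A. w (stage A m) \<tau> i = b)"
  by (rule measurable_compose[OF measurable_compose[OF stage_meas w_meas]]) simp

definition realized_in_M :: "'l qftype \<Rightarrow> bool" where
  "realized_in_M \<tau> \<longleftrightarrow> (\<exists>f y. inj_on f (fst \<tau>) \<and> f ` fst \<tau> \<subseteq> sdom M \<and> y \<in> sdom M \<and>
     y \<notin> f ` fst \<tau> \<and> \<tau> = type_of M (fst \<tau>) f y)"

text \<open>Replaces the quantifier over all extensions in the class by a condition that does not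
  depend on A, together with one that is a countable conjunction in A.\<close>

lemma adm_iff:
  assumes "A \<in> C"
  shows "adm A \<tau> \<longleftrightarrow> is_qftype ar A \<tau> \<and> realized_in_M \<tau>"
proof
  assume "adm A \<tau>"
  then show "is_qftype ar A \<tau> \<and> realized_in_M \<tau>"
    unfolding realized_in_M_def using admissible_imp_type_of[OF limit] adm_qftype by metis
next
  assume "is_qftype ar A \<tau> \<and> realized_in_M \<tau>"
  then show "adm A \<tau>"
    unfolding realized_in_M_def using admissible_type_of[OF M_in sap assms] by metis
qed

lemma pred_adm: "Measurable.pred N (\<lambda>A. adm (stage A m) \<tau>)"
proof -
  have "is_qftype ar S \<tau> \<longleftrightarrow> finite (fst \<tau>) \<and> (\<forall>x\<in>fst \<tau>. x \<in> sdom S) \<and>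
     (\<forall>l ys. snd \<tau> l ys \<longrightarrow> length ys = ar l \<and> set ys \<subseteq> insert None (Some ` fst \<tau>)) \<and>
     (\<forall>l xs. set xs \<subseteq> fst \<tau> \<longrightarrow> (snd \<tau> l (map Some xs) \<longleftrightarrow> srel S l xs))" for S
    by (auto simp: is_qftype_def)
  then have "Measurable.pred N (\<lambda>A. is_qftype ar (stage A m) \<tau> \<and> realized_in_M \<tau>)"
    by (simp only:) (intro pred_intros_logic pred_intros_countable pred_intros_countable_bounded
      pred_sdom_stage pred_srel_stage measurable_count_space_const)
  then show ?thesis
    by (rule measurable_cong[THEN iffD1, rotated]) (simp add: adm_iff stage_in)
qed

text \<open>The age of M is countable, so all admissible types over all members of C are captured by
  countably many codes; this is what makes the Borel unions over types below countable.\<close>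

definition coded_type :: "(nat \<times> nat) list \<times> nat \<Rightarrow> 'l qftype" where
  "coded_type c = type_of M (fst ` set (fst c)) (\<lambda>a. the (map_of (fst c) a)) (snd c)"

lemma adm_coded:
  assumes "adm A \<tau>"
  obtains c where "\<tau> = coded_type c"
proof -
  from assms obtain f y where f: "\<tau> = type_of M (fst \<tau>) f y"
    using admissible_imp_type_of[OF limit] by metis
  have "finite (fst \<tau>)" using adm_qftype[OF assms] by (simp add: is_qftype_def)
  then obtain xs where xs: "set xs = fst \<tau>" using finite_list by blast
  have "coded_type (map (\<lambda>x. (x, f x)) xs, y) = type_of M (fst \<tau>) f y"
    unfolding coded_type_def using xs
    by (auto simp: image_image map_of_map_restrict intro!: type_of_cong)
  with f that show ?thesis by metis
qed

text \<open>The inverse inclusion in the definition is replaced by a countable quantifier over its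
  value, which is unique because the inclusion is injective on the stage.\<close>

lemma pred_code: "Measurable.pred N (\<lambda>A. code A m x = z)"
proof (induction m arbitrary: x z)
  case 0
  show ?case by simp
next
  case (Suc m)
  have eq: "code A (Suc m) x = z \<longleftrightarrow>
      (\<exists>a. a \<in> sdom (stage A m) \<and> \<iota> (stage A m) a = x \<and> code A m a = z) \<or>
      (\<not> (\<exists>a. a \<in> sdom (stage A m) \<and> \<iota> (stage A m) a = x) \<and> prod_encode (Suc m, x) = z)"
    if "A \<in> C" for A
  proof (cases "x \<in> incl A m ` sdom (stage A m)")
    case True
    then obtain a where a: "a \<in> sdom (stage A m)" "x = incl A m a" by blast
    have "inj_on (incl A m) (sdom (stage A m))"
      using \<iota>_emb[OF stage_in[OF that, of m]] by (simp add: embedding_def incl_def)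
    then have "a' = a" if "a' \<in> sdom (stage A m)" "\<iota> (stage A m) a' = x" for a'
      using that a by (auto simp: incl_def dest: inj_onD)
    moreover have "code A (Suc m) x = code A m a"
      using chain.code_step[OF chain_stage[OF that] a(1)] a(2) by simp
    moreover have "\<iota> (stage A m) a = x" using a(2) by (simp add: incl_def)
    ultimately show ?thesis using a(1) by metis
  next
    case False
    then show ?thesis by (auto simp: incl_def)
  qed
  have "Measurable.pred N (\<lambda>A.
      (\<exists>a. a \<in> sdom (stage A m) \<and> \<iota> (stage A m) a = x \<and> code A m a = z) \<or>
      (\<not> (\<exists>a. a \<in> sdom (stage A m) \<and> \<iota> (stage A m) a = x) \<and> prod_encode (Suc m, x) = z))"
    by (intro pred_intros_logic pred_intros_countable pred_sdom_stage pred_\<iota> Suc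
      measurable_count_space_const)
  then show ?case
    by (rule measurable_cong[THEN iffD1, rotated]) (use eq in auto)
qed

text \<open>The guard on x is needed because outside the stage \<open>aut\<close> rests on arbitrary
  values of \<open>inv_into\<close>. The difficulty is the transported type, which depends on A
  while \<open>w\<close> is measurable only for a fixed type.\<close>

lemma pred_aut: "Measurable.pred N (\<lambda>A. x \<in> sdom (stage A m) \<and> aut A m x = z)"
proof (induction m arbitrary: x z)
  case 0
  have "Measurable.pred N (\<lambda>A. x \<in> sdom (stage A 0) \<and> x = z)"
    by (intro pred_intros_logic pred_sdom_stage measurable_count_space_const)
  then show ?case by simp
next
  case (Suc m)
  let ?old = "\<lambda>A. \<exists>a b. \<iota> (stage A m) a = x \<and>
      (a \<in> sdom (stage A m) \<and> aut A m a = b) \<and> \<iota> (stage A m) b = z"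
  \<comment> \<open>\<open>c\<close> codes the type witnessed by x, \<open>i\<close> is its index,
    and \<open>qs\<close> is a finite table of \<open>aut A m\<close> on the parameters. Once these
    countably many data are fixed, the transported type no longer depends on A.\<close>
  let ?new = "\<lambda>A. \<exists>c i qs. i \<in> {1..n} \<and> adm (stage A m) (coded_type c) \<and>
      w (stage A m) (coded_type c) i = x \<and> fst ` set qs = fst (coded_type c) \<and>
      (\<forall>q\<in>set qs. fst q \<in> sdom (stage A m) \<and> aut A m (fst q) = snd q) \<and>
      w (stage A m) (transport_type (\<lambda>a. the (map_of qs a)) (coded_type c)) (cyc_next n i) = z"
  have eq: "x \<in> sdom (stage A (Suc m)) \<and> aut A (Suc m) x = z \<longleftrightarrow> ?old A \<or> ?new A" if A: "A \<in> C" for A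
  proof -
    let ?S = "stage A m"
    have S: "?S \<in> C" using stage_in[OF A] .
    \<comment> \<open>Transport depends only on values at the parameters, so the table may stand in
      for the automorphism.\<close>
    have transport: "transport_type (\<lambda>a. the (map_of qs a)) \<tau> = transport_type (aut A m) \<tau>"
      if "adm ?S \<tau>" "fst ` set qs = fst \<tau>" "\<forall>q\<in>set qs. aut A m (fst q) = snd q" for qs \<tau>
    proof (rule transport_cong[OF adm_qftype[OF that(1)]])
      fix a assume "a \<in> fst \<tau>"
      then have "map_of qs a \<noteq> None" using that(2) by (simp add: map_of_eq_None_iff)
      then obtain b where "map_of qs a = Some b" by blast
      with that(3) map_of_SomeD[OF this] show "the (map_of qs a) = aut A m a" by auto
    qed
    show ?thesis
    proof
      assume x: "x \<in> sdom (stage A (Suc m)) \<and> aut A (Suc m) x = z"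
      then have "x \<in> sdom (E ?S)" by simp
      with S show "?old A \<or> ?new A"
      proof (cases rule: E_cases)
        case (old a)
        with x ext_\<iota>[OF S old(1)] show ?thesis by auto
      next
        case (new \<tau> i)
        from adm_coded[OF new(1)] obtain c where c: "\<tau> = coded_type c" .
        have "finite (fst \<tau>)" using adm_qftype[OF new(1)] by (simp add: is_qftype_def)
        then obtain xs where xs: "set xs = fst \<tau>" using finite_list by blast
        define qs where "qs = map (\<lambda>a. (a, aut A m a)) xs"
        have qs: "fst ` set qs = fst \<tau>" "\<forall>q\<in>set qs. fst q \<in> sdom ?S \<and> aut A m (fst q) = snd q"
          using xs adm_fst[OF new(1)] by (auto simp: qs_def image_image)
        have "z = w ?S (transport_type (aut A m) \<tau>) (cyc_next n i)"
          using x ext_w[OF S new(1,2)] new(3) by simp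
        then have "w ?S (transport_type (\<lambda>a. the (map_of qs a)) \<tau>) (cyc_next n i) = z"
          using transport[OF new(1) qs(1)] qs(2) by simp
        with new qs have "?new A" unfolding c by blast
        then show ?thesis ..
      qed
    next
      assume "?old A \<or> ?new A"
      then show "x \<in> sdom (stage A (Suc m)) \<and> aut A (Suc m) x = z"
      proof
        assume "?old A"
        then obtain a where a: "a \<in> sdom ?S" "x = \<iota> ?S a" "z = \<iota> ?S (aut A m a)" by auto
        moreover have "\<iota> ?S a \<in> sdom (E ?S)" using a(1) \<iota>_emb[OF S] by (auto simp: embedding_def)
        ultimately show ?thesis by (simp add: ext_\<iota>[OF S])
      next
        assume "?new A"
        then obtain c i qs where c: "i \<in> {1..n}" "adm ?S (coded_type c)"
          "w ?S (coded_type c) i = x" "fst ` set qs = fst (coded_type c)"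
          "\<forall>q\<in>set qs. aut A m (fst q) = snd q"
          "w ?S (transport_type (\<lambda>a. the (map_of qs a)) (coded_type c)) (cyc_next n i) = z"
          by blast
        have "x \<in> sdom (E ?S)" using w_in[OF S c(2,1)] c(3) by simp
        moreover have "aut A (Suc m) x = z"
          using ext_w[OF S c(2,1)] c(3,6) transport[OF c(2,4,5)] by auto
        ultimately show ?thesis by simp
      qed
    qed
  qed
  have "Measurable.pred N (\<lambda>A. ?old A \<or> ?new A)"
    by (intro pred_intros_logic(2-) pred_intros_countable pred_intros_countable_bounded(3) pred_adm pred_w pred_\<iota>
      Suc measurable_count_space_const)
  then show ?case
    by (rule measurable_cong[THEN iffD1, rotated]) (use eq in auto)
qed

lemma W_meas: "W \<in> measurable N struc_space"
proof (rule measurable_struc_spaceI)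
  fix z
  have "Measurable.pred N (\<lambda>A. \<exists>m x. x \<in> sdom (stage A m) \<and> code A m x = z)"
    by (intro pred_intros_logic pred_intros_countable pred_sdom_stage pred_code)
  moreover have "z \<in> sdom (W A) \<longleftrightarrow> (\<exists>m x. x \<in> sdom (stage A m) \<and> code A m x = z)" for A
    unfolding sdom_chain_limit by blast
  ultimately show "Measurable.pred N (\<lambda>A. z \<in> sdom (W A))" by (simp only:)
next
  fix l zs
  \<comment> \<open>Equality of tuples is written coordinatewise because measurability is known for
    one value of \<open>code\<close> at a time.\<close>
  have "Measurable.pred N (\<lambda>A. \<exists>m xs. (\<forall>x\<in>set xs. x \<in> sdom (stage A m)) \<and>
      (length zs = length xs \<and> (\<forall>i\<in>{..<length zs}. code A m (xs ! i) = zs ! i)) \<and> srel (stage A m) l xs)"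
    by (intro pred_intros_logic pred_intros_countable pred_intros_countable_bounded
      pred_sdom_stage pred_srel_stage pred_code measurable_count_space_const)
  moreover have "zs = map (code A m) xs \<longleftrightarrow>
      length zs = length xs \<and> (\<forall>i\<in>{..<length zs}. code A m (xs ! i) = zs ! i)" for A m xs
    unfolding list_eq_iff_nth_eq by auto
  moreover have "set xs \<subseteq> D \<longleftrightarrow> (\<forall>x\<in>set xs. x \<in> D)" for xs and D :: "nat set" by blast
  ultimately show "Measurable.pred N (\<lambda>A. srel (W A) l zs)" by (simp only: srel_chain_limit)
qed

text \<open>The arbitrary representative chosen by \<open>chain_map\<close> is replaced by a
  countable quantifier over all representatives; by \<open>\<Phi>_code\<close> they all give the
  same value.\<close>

lemma pred_\<Phi>: "Measurable.pred N (\<lambda>A. z \<in> sdom (W A) \<and> \<Phi> A z = z')"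
proof -
  have eq: "z \<in> sdom (W A) \<and> \<Phi> A z = z' \<longleftrightarrow> (\<exists>m x x'. code A m x = z \<and>
      (x \<in> sdom (stage A m) \<and> aut A m x = x') \<and> code A m x' = z')" (is "_ \<longleftrightarrow> ?R A")
    if A: "A \<in> C" for A
  proof
    assume z: "z \<in> sdom (W A) \<and> \<Phi> A z = z'"
    then obtain m x where x: "x \<in> sdom (stage A m)" "z = code A m x"
      unfolding sdom_chain_limit by blast
    with z \<Phi>_code[OF A x(1)] show "?R A" by metis
  next
    assume "?R A"
    then obtain m x where x: "x \<in> sdom (stage A m)" "z = code A m x" "code A m (aut A m x) = z'"
      by blast
    with \<Phi>_code[OF A x(1)] show "z \<in> sdom (W A) \<and> \<Phi> A z = z'"
      unfolding sdom_chain_limit by blast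
  qed
  have "Measurable.pred N ?R"
    by (intro pred_intros_logic(2-) pred_intros_countable pred_code pred_aut)
  then show ?thesis
    by (rule measurable_cong[THEN iffD1, rotated]) (use eq in auto)
qed

section \<open>The reduction\<close>

text \<open>\<open>\<Phi> A\<close> carried over to M along the back-and-forth isomorphism; off the
  universe of M it is the identity, as \<open>Aut\<close> requires.\<close>

definition reduction :: "'l struc \<Rightarrow> nat \<Rightarrow> nat" where
  "reduction A x = (if x \<in> sdom M
     then bf_map M (W A) (\<Phi> A (inv_into (sdom (W A)) (bf_map M (W A)) x)) else x)"

lemma bf_isomorphism: "A \<in> C \<Longrightarrow> isomorphism (W A) M (bf_map M (W A))"
  using back_forth_isomorphism(1)[OF limit W_in ext_prop_W] .

lemma reduction_bf:
  assumes "A \<in> C" "z \<in> sdom (W A)"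
  shows "reduction A (bf_map M (W A) z) = bf_map M (W A) (\<Phi> A z)"
  using bf_isomorphism[OF assms(1)] assms(2)
  by (auto simp: reduction_def isomorphism_def embedding_def)

lemma reduction_Aut:
  assumes A: "A \<in> C"
  shows "reduction A \<in> Aut M"
proof -
  let ?h = "bf_map M (W A)"
  have "isomorphism M M (?h \<circ> (\<Phi> A \<circ> inv_into (sdom (W A)) ?h))"
    using isomorphism_comp[OF isomorphism_comp[OF isomorphism_inv_into[OF bf_isomorphism[OF A]]
      \<Phi>_isomorphism[OF A]] bf_isomorphism[OF A]] .
  then have "isomorphism M M (reduction A)"
    by (rule isomorphism_cong) (simp add: reduction_def)
  then show ?thesis by (simp add: Aut_def reduction_def)
qed

lemma reduction_meas: "reduction \<in> measurable N baire_space"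
proof (rule measurable_baire_spaceI)
  fix x y
  show "Measurable.pred N (\<lambda>A. reduction A x = y)"
  proof (cases "x \<in> sdom M")
    case False
    then show ?thesis by (simp add: reduction_def)
  next
    case True
    let ?H = "\<lambda>A a b. \<exists>k. (a, b) \<in> set (back_forth M (W A) k)"
    \<comment> \<open>The composite is read as a relation: both the back-and-forth map and its
      inverse enter only through the graph \<open>?H\<close>, so the inverse needs no separate
      treatment.\<close>
    have eq: "reduction A x = y \<longleftrightarrow>
        (\<exists>a b. ?H A a x \<and> (a \<in> sdom (W A) \<and> \<Phi> A a = b) \<and> ?H A b y)" (is "_ \<longleftrightarrow> ?R A")
      if A: "A \<in> C" for A
    proof -
      note H = back_forth_isomorphism(2)[OF limit W_in[OF A] ext_prop_W[OF A]]
      have "x \<in> bf_map M (W A) ` sdom (W A)"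
        using bf_isomorphism[OF A] True by (simp add: isomorphism_def)
      then obtain a where a: "a \<in> sdom (W A)" "bf_map M (W A) a = x" by blast
      have inj: "inj_on (bf_map M (W A)) (sdom (W A))"
        using bf_isomorphism[OF A] by (simp add: isomorphism_def embedding_def)
      have \<Phi>a: "\<Phi> A a \<in> sdom (W A)" using \<Phi>_isomorphism[OF A] a(1) by (auto simp: isomorphism_def)
      have "reduction A x = bf_map M (W A) (\<Phi> A a)" using reduction_bf[OF A a(1)] a(2) by simp
      moreover have "a' = a" if "a' \<in> sdom (W A)" "bf_map M (W A) a' = x" for a'
        using inj that a by (metis inj_onD)
      ultimately show ?thesis unfolding H using a \<Phi>a by metis
    qed
    have "Measurable.pred N ?R"
      by (intro pred_intros_logic(3) pred_intros_countable pred_back_forth W_meas pred_\<Phi>)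
    then show ?thesis
      by (rule measurable_cong[THEN iffD1, rotated]) (use eq in auto)
  qed
qed

lemma reduction_iff:
  assumes A: "A \<in> C" "A' \<in> C"
  shows "isomorphic A A' \<longleftrightarrow> conjugate M (reduction A) (reduction A')"
proof
  let ?h = "bf_map M (W A)" and ?h' = "bf_map M (W A')"
  let ?g = "inv_into (sdom (W A)) ?h" and ?g' = "inv_into (sdom (W A')) ?h'"
  note h = bf_isomorphism[OF A(1)] and h' = bf_isomorphism[OF A(2)]
  note g = isomorphism_inv_into[OF h] and g' = isomorphism_inv_into[OF h']
  have hg: "?h (?g x) = x" if "x \<in> sdom M" for x
    using h that by (auto simp: isomorphism_def f_inv_into_f)
  have hg': "?h' (?g' x) = x" if "x \<in> sdom M" for x
    using h' that by (auto simp: isomorphism_def f_inv_into_f)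
  have gh: "?g (?h z) = z" if "z \<in> sdom (W A)" for z
    using h that by (auto simp: isomorphism_def embedding_def)
  have gh': "?g' (?h' z) = z" if "z \<in> sdom (W A')" for z
    using h' that by (auto simp: isomorphism_def embedding_def)
  {
    assume "isomorphic A A'"
    then obtain \<alpha> where "isomorphism A A' \<alpha>" unfolding isomorphic_def by blast
    from isomorphic_imp_conjugating[OF A this] obtain \<gamma> where \<gamma>: "isomorphism (W A) (W A') \<gamma>"
      "\<And>z. z \<in> sdom (W A) \<Longrightarrow> \<gamma> (\<Phi> A z) = \<Phi> A' (\<gamma> z)" by blast
    \<comment> \<open>The two limits are identified with M by different maps, so the conjugator is
      \<open>\<gamma>\<close> framed by both of them.\<close>
    define \<beta> where "\<beta> x = (if x \<in> sdom M then ?h' (\<gamma> (?g x)) else x)" for x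
    have "isomorphism M M \<beta>"
      using isomorphism_comp[OF isomorphism_comp[OF g \<gamma>(1)] h']
      by (rule isomorphism_cong) (simp add: \<beta>_def)
    then have "\<beta> \<in> Aut M" by (simp add: Aut_def \<beta>_def)
    moreover have "\<beta> (reduction A x) = reduction A' (\<beta> x)" if x: "x \<in> sdom M" for x
    proof -
      define z where "z = ?g x"
      have z: "z \<in> sdom (W A)" "?h z = x" using isomorphism_in[OF g x] hg[OF x] by (simp_all add: z_def)
      have \<beta>h: "\<beta> (?h u) = ?h' (\<gamma> u)" if "u \<in> sdom (W A)" for u
        using isomorphism_in[OF h that] gh[OF that] by (simp add: \<beta>_def)
      have "\<beta> (reduction A x) = \<beta> (?h (\<Phi> A z))" using reduction_bf[OF A(1) z(1)] z(2) by simp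
      also have "\<dots> = ?h' (\<Phi> A' (\<gamma> z))"
        using \<beta>h[OF isomorphism_in[OF \<Phi>_isomorphism[OF A(1)] z(1)]] \<gamma>(2)[OF z(1)] by simp
      also have "\<dots> = reduction A' (\<beta> x)"
        using reduction_bf[OF A(2) isomorphism_in[OF \<gamma>(1) z(1)]] \<beta>h[OF z(1)] z(2) by simp
      finally show ?thesis .
    qed
    ultimately show "conjugate M (reduction A) (reduction A')" unfolding conjugate_def by blast
  next
    assume "conjugate M (reduction A) (reduction A')"
    then obtain \<beta> where \<beta>: "\<beta> \<in> Aut M" "\<And>x. x \<in> sdom M \<Longrightarrow> \<beta> (reduction A x) = reduction A' (\<beta> x)"
      unfolding conjugate_def by blast
    have \<beta>iso: "isomorphism M M \<beta>" using \<beta>(1) by (simp add: Aut_def)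
    let ?\<gamma> = "?g' \<circ> (\<beta> \<circ> ?h)"
    have \<gamma>: "isomorphism (W A) (W A') ?\<gamma>"
      by (intro isomorphism_comp[OF isomorphism_comp[OF h \<beta>iso] g'])
    have "?\<gamma> (\<Phi> A z) = \<Phi> A' (?\<gamma> z)" if z: "z \<in> sdom (W A)" for z
    proof -
      have \<gamma>z: "?\<gamma> z \<in> sdom (W A')" using isomorphism_in[OF \<gamma> z] .
      have h\<gamma>: "?h' (?\<gamma> z) = \<beta> (?h z)" using hg'[OF isomorphism_in[OF \<beta>iso isomorphism_in[OF h z]]] by simp
      have "?\<gamma> (\<Phi> A z) = ?g' (\<beta> (reduction A (?h z)))" using reduction_bf[OF A(1) z] by simp
      also have "\<dots> = ?g' (reduction A' (?h' (?\<gamma> z)))" using \<beta>(2)[OF isomorphism_in[OF h z]] h\<gamma> by simp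
      also have "\<dots> = ?g' (?h' (\<Phi> A' (?\<gamma> z)))" using reduction_bf[OF A(2) \<gamma>z] by simp
      also have "\<dots> = \<Phi> A' (?\<gamma> z)" using gh'[OF isomorphism_in[OF \<Phi>_isomorphism[OF A(2)] \<gamma>z]] .
      finally show ?thesis .
    qed
    with A \<gamma> show "isomorphic A A'" by (rule conjugating_imp_isomorphic)
  }
qed

lemma borel_reducible_conjugacy:
  "borel_reducible C isomorphic struc_space (Aut M) (conjugate M) baire_space"
  unfolding borel_reducible_def
  by (intro exI[of _ reduction] conjI ballI reduction_meas reduction_Aut reduction_iff)

end

theorem theorem5p4:
  fixes ar :: "'l::countable \<Rightarrow> nat"
    and K :: "'l struc set"
    and M :: "'l struc"
    and n :: nat
  assumes "\<forall>A\<in>K. wf_struc ar A \<and> finite (sdom A)"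
    and "n \<ge> 2"
    and "BAP n ar (K_omega ar K)"
    and "fraisse_limit ar K M"
  shows "borel_reducible (K_omega ar K) isomorphic struc_space (Aut M) (conjugate M) baire_space"
proof -
  show ?thesis
    using assms(3) unfolding BAP_def
    apply (elim conjE exE)
    subgoal premises prems for E \<iota> w
    proof -
      note dest = prems(6)[THEN bspec]
      have "borel_amalgamation ar K M n E \<iota> w"
        by (rule borel_amalgamation.intro)
          (fact assms(2,4) prems(1-2) prems(3-5)[rule_format] dest[THEN conjunct1]
            dest[THEN conjunct2, THEN conjunct1]
            dest[THEN conjunct2, THEN conjunct2, THEN conjunct1]
            dest[THEN conjunct2, THEN conjunct2, THEN conjunct2, THEN conjunct1]
            dest[THEN conjunct2, THEN conjunct2, THEN conjunct2, THEN conjunct2, rule_format, OF _ conjI]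
            prems(7)[THEN bspec] prems(9)[rule_format])+
      then show ?thesis by (rule borel_amalgamation.borel_reducible_conjugacy)
    qed
    done
qed

end
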